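(* Let $\Gamma\subset\mathbb{R}^2$ be a smooth curve such that there are constants $0<c_1\le c_2<\infty$ with $c_1\le|x-\gamma|\le c_2$ for all $x\in[0,1]^2$ and $\gamma\in\Gamma$, and such that no tangent line to $\Gamma$ passes through $[0,1]^2$. Then there is a constant $c>0$ such that for all $n\ge1$, $$\int_\Gamma\operatorname{vis}(a,\mathcal K_n)\,d\mathcal H^1(a)\ge\frac{c}{n}.$$
   Context: $\mathcal K_n$ is the $n$-th generation in the construction of the four corner Cantor set: $\mathcal K_0=[0,1]^2$; $\mathcal K_1$ is obtained by dividing the unit square into 16 axis-parallel closed squares of side length $1/4$ and keeping the four corner ones; and $\mathcal K_{n+1}$ is obtained by repeating this within each square of $\mathcal K_n$. Thus $\mathcal K_n$ is a union of $4^n$ closed squares of side length $4^{-n}$. For $a\in\mathbb{R}^2$, $P_a(x)=\frac{x-a}{|x-a|}$ for $x\ne a$, and $\operatorname{vis}(a,S)=|P_a(S)|$, where $|\cdot|$ is one-dimensional Hausdorff measure on the unit circle. *)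

theory Defs
  imports "HOL-Analysis.Analysis"
begin

text \<open>One-dimensional Hausdorff measure, with the normalisation that makes it agree with length.
  Boundedness of the covering sets is demanded explicitly because \<^const>\<open>diameter\<close> has no
  meaningful value on unbounded sets.\<close>

definition hausdorff1_delta :: "real \<Rightarrow> 'a::metric_space set \<Rightarrow> ennreal" where
  "hausdorff1_delta \<delta> A =
     (INF U \<in> {U :: nat \<Rightarrow> 'a set.
         A \<subseteq> (\<Union>i. U i) \<and> (\<forall>i. bounded (U i) \<and> diameter (U i) \<le> \<delta>)}.
       \<Sum>i. ennreal (diameter (U i)))"

definition hausdorff1_outer :: "'a::metric_space set \<Rightarrow> ennreal" where
  "hausdorff1_outer A = (SUP \<delta> \<in> {0<..}. hausdorff1_delta \<delta> A)"

text \<open>The restriction of the outer measure to the Borel sets. Since \<^const>\<open>hausdorff1_outer\<close> is a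
  metric outer measure, it is countably additive there (Caratheodory), so the value of
  \<^const>\<open>emeasure\<close> on Borel sets is the outer measure and not the default value 0 of
  \<^const>\<open>measure_of\<close>.\<close>

definition hausdorff1 :: "'a::metric_space measure" where
  "hausdorff1 = measure_of UNIV (sets borel) hausdorff1_outer"

definition radial_proj :: "real^2 \<Rightarrow> real^2 \<Rightarrow> real^2" where
  "radial_proj a x = (x - a) /\<^sub>R norm (x - a)"

text \<open>The outer measure is used so that visibility makes sense for every set.\<close>

definition vis :: "real^2 \<Rightarrow> (real^2) set \<Rightarrow> ennreal" where
  "vis a S = hausdorff1_outer (radial_proj a ` (S - {a}))"

definition square :: "real^2 \<Rightarrow> real \<Rightarrow> (real^2) set" where
  "square p s = cbox p (p + s *\<^sub>R vector [1, 1])"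

text \<open>Lower left corners of the squares of the \<open>n\<close>-th generation, which have side length
  \<open>(1/4)^n\<close>. The 16 subsquares of a square with lower left corner \<open>p\<close> and side length \<open>s\<close> have
  lower left corners \<open>p + (s/4) (i, j)\<close> with \<open>i, j \<in> {0, 1, 2, 3}\<close>; the four
  corner ones are those with \<open>i, j \<in> {0, 3}\<close>.\<close>

fun cantor_corners :: "nat \<Rightarrow> (real^2) set" where
  "cantor_corners 0 = {0}"
| "cantor_corners (Suc n) =
     {p + ((1/4)^n / 4) *\<^sub>R vector [i, j] | p i j.
        p \<in> cantor_corners n \<and> i \<in> {0, 3} \<and> j \<in> {0, 3}}"

definition four_corner :: "nat \<Rightarrow> (real^2) set" where
  "four_corner n = (\<Union>p \<in> cantor_corners n. square p ((1/4)^n))"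

text \<open>\<open>D k\<close> is the \<open>k\<close>-th derivative (one-sided at endpoints belonging to \<open>I\<close>).\<close>

definition smooth_on_interval :: "real set \<Rightarrow> (real \<Rightarrow> real^2) \<Rightarrow> bool" where
  "smooth_on_interval I \<gamma> \<longleftrightarrow>
     (\<exists>D :: nat \<Rightarrow> real \<Rightarrow> real^2. D 0 = \<gamma> \<and>
        (\<forall>k. \<forall>t\<in>I. (D k has_vector_derivative D (Suc k) t) (at t within I)))"

text \<open>A smooth curve is the image of a nondegenerate interval (open, closed or neither) under a
  smooth map with nowhere vanishing derivative. Injectivity is not required, so closed curves
  are included.\<close>

definition smooth_curve_param :: "real set \<Rightarrow> (real \<Rightarrow> real^2) \<Rightarrow> bool" where
  "smooth_curve_param I \<gamma> \<longleftrightarrow>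
     is_interval I \<and> (\<exists>s\<in>I. \<exists>t\<in>I. s < t) \<and> smooth_on_interval I \<gamma> \<and>
     (\<forall>t\<in>I. vector_derivative \<gamma> (at t within I) \<noteq> 0)"

definition tangent_line :: "real set \<Rightarrow> (real \<Rightarrow> real^2) \<Rightarrow> real \<Rightarrow> (real^2) set" where
  "tangent_line I \<gamma> t = range (\<lambda>r. \<gamma> t + r *\<^sub>R vector_derivative \<gamma> (at t within I))"

end

theory Submission
  imports Defs
begin

text \<open>Let \<open>e\<close> be the unit tangent of \<open>\<Gamma>\<close> at one of its points and \<open>f\<close> the unit normal pointing
  towards the square. For \<open>a\<close> on a small arc around this point, the slope
  \<open>((x - a) \<bullet> e) / ((x - a) \<bullet> f)\<close> is a Lipschitz function of the direction of \<open>x - a\<close>, so it suffices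
  to bound the measure of the set of slopes of \<open>K\<^sub>n\<close> from below. Each of the \<open>4^n\<close> squares contains
  a segment parallel to \<open>e\<close>, whose slopes fill an interval of length \<open>h\<close> comparable to
  \<open>4^(-n)\<close>. By Cauchy-Schwarz the union of these intervals has measure at least
  \<open>16^n h / M(a)\<close>, where \<open>M(a)\<close> counts the pairs of squares whose slopes differ by at most \<open>h\<close>.
  Lines through the square cross the arc transversally, hence the slopes of \<open>x\<close> and \<open>y\<close> are
  \<open>h\<close>-close only for a set of parameters of measure \<open>O(h / |x - y|)\<close>. The discrete energy
  \<open>\<Sum> 1 / |x - y|\<close> is at most \<open>2 n 16^n\<close> by self-similarity, so the mean of \<open>M\<close> over the arc is
  \<open>O(n 4^n)\<close>, and by Markov's inequality \<open>M = O(n 4^n)\<close> on at least half of the arc.\<close>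

subsection \<open>One-dimensional Hausdorff measure\<close>

lemma hausdorff1_delta_le:
  assumes "A \<subseteq> (\<Union>i. U i)" and "\<And>i. bounded (U i)" and "\<And>i. diameter (U i) \<le> \<delta>"
  shows "hausdorff1_delta \<delta> A \<le> (\<Sum>i. ennreal (diameter (U i)))"
  unfolding hausdorff1_delta_def using assms by (intro INF_lower) auto

lemma hausdorff1_delta_geI:
  assumes "\<And>U. A \<subseteq> (\<Union>i. U i) \<Longrightarrow> (\<And>i. bounded (U i)) \<Longrightarrow> (\<And>i. diameter (U i) \<le> \<delta>)
             \<Longrightarrow> x \<le> (\<Sum>i::nat. ennreal (diameter (U i)))"
  shows "x \<le> hausdorff1_delta \<delta> A"
  unfolding hausdorff1_delta_def using assms by (intro INF_greatest) auto

lemma hausdorff1_delta_mono: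
  assumes "A \<subseteq> B" shows "hausdorff1_delta \<delta> A \<le> hausdorff1_delta \<delta> B"
  using assms by (intro hausdorff1_delta_geI hausdorff1_delta_le) auto

lemma hausdorff1_delta_antimono:
  assumes "\<delta> \<le> \<delta>'" shows "hausdorff1_delta \<delta>' A \<le> hausdorff1_delta \<delta> A"
  using assms by (intro hausdorff1_delta_geI hausdorff1_delta_le) (auto intro: order_trans)

text \<open>Covers of the sets \<open>A i\<close> that are optimal up to an error
  \<open>e / 2^(i+1)\<close> are merged into a single sequence by \<open>prod_decode\<close>; the
  errors add up to \<open>e\<close>.\<close>

lemma hausdorff1_delta_countably_subadditive:
  fixes A :: "nat \<Rightarrow> 'a::metric_space set"
  shows "hausdorff1_delta \<delta> (\<Union>i. A i) \<le> (\<Sum>i. hausdorff1_delta \<delta> (A i))"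
proof (rule ennreal_le_epsilon)
  fix e :: real assume e: "0 < e" and fin: "(\<Sum>i. hausdorff1_delta \<delta> (A i)) < top"
  have "\<exists>U. A i \<subseteq> (\<Union>j. U j) \<and> (\<forall>j. bounded (U j) \<and> diameter (U j) \<le> \<delta>) \<and>
          (\<Sum>j::nat. ennreal (diameter (U j))) \<le> hausdorff1_delta \<delta> (A i) + ennreal (e * (1/2)^Suc i)" for i
  proof -
    have "hausdorff1_delta \<delta> (A i) < top"
      using fin by (rule ennreal_suminf_lessD)
    then have "hausdorff1_delta \<delta> (A i) < hausdorff1_delta \<delta> (A i) + ennreal (e * (1/2)^Suc i)"
      using e by (cases "hausdorff1_delta \<delta> (A i)") (auto simp: ennreal_plus[symmetric] ennreal_less_iff simp del: ennreal_plus)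
    then obtain U where "U \<in> {U. A i \<subseteq> (\<Union>j. U j) \<and> (\<forall>j::nat. bounded (U j) \<and> diameter (U j) \<le> \<delta>)}"
      and "(\<Sum>j. ennreal (diameter (U j))) < hausdorff1_delta \<delta> (A i) + ennreal (e * (1/2)^Suc i)"
      unfolding hausdorff1_delta_def[of \<delta> "A i"] INF_less_iff by blast
    then show ?thesis
      by (auto intro!: exI[of _ U] less_imp_le)
  qed
  then obtain U where U: "\<And>i. A i \<subseteq> (\<Union>j. U i j)" "\<And>i j. bounded (U i j)" "\<And>i j. diameter (U i j) \<le> \<delta>"
    "\<And>i. (\<Sum>j::nat. ennreal (diameter (U i j))) \<le> hausdorff1_delta \<delta> (A i) + ennreal (e * (1/2)^Suc i)"
    by metis
  have "hausdorff1_delta \<delta> (\<Union>i. A i) \<le> (\<Sum>k. ennreal (diameter (case prod_decode k of (i, j) \<Rightarrow> U i j)))"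
  proof (rule hausdorff1_delta_le)
    show "(\<Union>i. A i) \<subseteq> (\<Union>k. case prod_decode k of (i, j) \<Rightarrow> U i j)"
    proof
      fix x assume "x \<in> (\<Union>i. A i)"
      then obtain i j where "x \<in> U i j" using U(1) by blast
      then have "x \<in> (case prod_decode (prod_encode (i, j)) of (i, j) \<Rightarrow> U i j)" by simp
      then show "x \<in> (\<Union>k. case prod_decode k of (i, j) \<Rightarrow> U i j)" by (rule UN_I[OF UNIV_I])
    qed
  qed (auto simp: U split: prod.split)
  also have "\<dots> = (\<Sum>k. (\<lambda>(i, j). ennreal (diameter (U i j))) (prod_decode k))"
    by (intro suminf_cong) (auto split: prod.split)
  also have "\<dots> = (\<Sum>i. \<Sum>j. ennreal (diameter (U i j)))"
    using suminf_ennreal_2dimen[of "\<lambda>i. \<Sum>j. ennreal (diameter (U i j))" "\<lambda>(i, j). ennreal (diameter (U i j))"]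
    by (simp add: comp_def)
  also have "\<dots> \<le> (\<Sum>i. hausdorff1_delta \<delta> (A i) + ennreal (e * (1/2)^Suc i))"
    by (intro suminf_le U) auto
  also have "\<dots> = (\<Sum>i. hausdorff1_delta \<delta> (A i)) + (\<Sum>i. ennreal (e * (1/2)^Suc i))"
    by (intro suminf_add[symmetric]) auto
  also have "(\<Sum>i. ennreal (e * (1/2)^Suc i)) = ennreal e"
    using e sums_mult[OF power_half_series, of e]
    by (intro suminf_ennreal_eq) auto
  finally show "hausdorff1_delta \<delta> (\<Union>i. A i) \<le> (\<Sum>i. hausdorff1_delta \<delta> (A i)) + ennreal e" .
qed

lemma hausdorff1_outer_mono: "A \<subseteq> B \<Longrightarrow> hausdorff1_outer A \<le> hausdorff1_outer B"
  unfolding hausdorff1_outer_def by (intro SUP_mono) (use hausdorff1_delta_mono in blast)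

lemma hausdorff1_outer_empty [simp]: "hausdorff1_outer {} = 0"
proof -
  have "hausdorff1_delta \<delta> ({} :: 'a set) \<le> 0" if "\<delta> > 0" for \<delta>
    using hausdorff1_delta_le[of "{}" "\<lambda>_. {}" \<delta>] that by simp
  then have "hausdorff1_outer ({} :: 'a set) \<le> 0"
    unfolding hausdorff1_outer_def by (intro SUP_least) auto
  then show ?thesis by simp
qed

lemma hausdorff1_outer_countably_subadditive:
  fixes A :: "nat \<Rightarrow> 'a::metric_space set"
  shows "hausdorff1_outer (\<Union>i. A i) \<le> (\<Sum>i. hausdorff1_outer (A i))"
proof -
  have "hausdorff1_delta \<delta> (\<Union>i. A i) \<le> (\<Sum>i. hausdorff1_outer (A i))" if "\<delta> > 0" for \<delta>
  proof -
    have "(\<Sum>i. hausdorff1_delta \<delta> (A i)) \<le> (\<Sum>i. hausdorff1_outer (A i))"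
      unfolding hausdorff1_outer_def using that by (intro suminf_le SUP_upper) auto
    then show ?thesis
      using hausdorff1_delta_countably_subadditive[of \<delta> A] by order
  qed
  then show ?thesis
    unfolding hausdorff1_outer_def[of "\<Union>i. A i"] by (intro SUP_least) auto
qed

section \<open>Caratheodory's criterion for the Borel sets\<close>

lemma outer_measure_space_hausdorff1_outer:
  "outer_measure_space (Pow UNIV) (hausdorff1_outer :: 'a::metric_space set \<Rightarrow> ennreal)"
  unfolding outer_measure_space_def positive_def increasing_def countably_subadditive_def
  by (auto intro: hausdorff1_outer_mono hausdorff1_outer_countably_subadditive)

text \<open>A set of diameter less than \<open>d\<close> cannot meet both \<open>A\<close> and
  \<open>B\<close>. A fine enough cover of the union therefore splits into the sets that meet
  \<open>A\<close>, which cover \<open>A\<close>, and the others, which cover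
  \<open>B\<close>.\<close>

lemma hausdorff1_outer_separated:
  fixes A B :: "'a::metric_space set"
  assumes "d > 0" and sep: "\<And>x y. x \<in> A \<Longrightarrow> y \<in> B \<Longrightarrow> d \<le> dist x y"
  shows "hausdorff1_outer A + hausdorff1_outer B \<le> hausdorff1_outer (A \<union> B)"
proof -
  have *: "hausdorff1_delta \<delta> A + hausdorff1_delta \<delta> B \<le> hausdorff1_delta \<delta> (A \<union> B)"
    if "0 < \<delta>" "\<delta> < d" for \<delta>
  proof (rule hausdorff1_delta_geI)
    fix U :: "nat \<Rightarrow> 'a set"
    assume U: "A \<union> B \<subseteq> (\<Union>i. U i)" "\<And>i. bounded (U i)" "\<And>i. diameter (U i) \<le> \<delta>"
    define V where "V i = (if U i \<inter> A = {} then {} else U i)" for i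
    define W where "W i = (if U i \<inter> A = {} then U i else {})" for i
    have "hausdorff1_delta \<delta> A \<le> (\<Sum>i. ennreal (diameter (V i)))"
    proof (rule hausdorff1_delta_le)
      show "A \<subseteq> (\<Union>i. V i)"
        using U(1) by (fastforce simp: V_def)
    qed (use U that in \<open>auto simp: V_def\<close>)
    moreover have "hausdorff1_delta \<delta> B \<le> (\<Sum>i. ennreal (diameter (W i)))"
    proof (rule hausdorff1_delta_le)
      show "B \<subseteq> (\<Union>i. W i)"
      proof
        fix y assume y: "y \<in> B"
        then obtain i where i: "y \<in> U i" using U(1) by blast
        have "U i \<inter> A = {}"
        proof (rule ccontr)
          assume "U i \<inter> A \<noteq> {}"
          then obtain x where "x \<in> U i" "x \<in> A" by blast
          with sep[of x y] y i U(2,3)[of i] diameter_bounded_bound[of "U i" x y] that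
          show False by auto
        qed
        with i show "y \<in> (\<Union>i. W i)" by (auto simp: W_def)
      qed
    qed (use U that in \<open>auto simp: W_def\<close>)
    moreover have "(\<Sum>i. ennreal (diameter (V i))) + (\<Sum>i. ennreal (diameter (W i)))
        = (\<Sum>i. ennreal (diameter (U i)))"
      by (subst suminf_add) (auto simp: V_def W_def intro!: suminf_cong)
    ultimately show "hausdorff1_delta \<delta> A + hausdorff1_delta \<delta> B \<le> (\<Sum>i. ennreal (diameter (U i)))"
      by (metis add_mono)
  qed
  have eq: "hausdorff1_outer X = (SUP \<delta>\<in>{0<..}. hausdorff1_delta \<delta> X)" for X :: "'a set"
    by (simp add: hausdorff1_outer_def)
  have "hausdorff1_outer A + hausdorff1_outer B
      = (SUP \<delta>\<in>{0<..}. hausdorff1_delta \<delta> A + hausdorff1_delta \<delta> B)"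
    unfolding eq
  proof (rule SUP_add_directed_ennreal[symmetric])
    fix i j :: real assume "i \<in> {0<..}" "j \<in> {0<..}"
    then show "\<exists>k\<in>{0<..}. hausdorff1_delta i A + hausdorff1_delta j B
        \<le> hausdorff1_delta k A + hausdorff1_delta k B"
      by (intro bexI[of _ "min i j"] add_mono hausdorff1_delta_antimono) auto
  qed
  also have "\<dots> \<le> hausdorff1_outer (A \<union> B)"
  proof (rule SUP_least)
    fix \<delta> :: real assume "\<delta> \<in> {0<..}"
    define \<epsilon> where "\<epsilon> = min \<delta> (d/2)"
    have e: "0 < \<epsilon>" "\<epsilon> < d" "\<epsilon> \<le> \<delta>" using \<open>\<delta> \<in> _\<close> \<open>d > 0\<close> by (auto simp: \<epsilon>_def)
    have "hausdorff1_delta \<delta> A + hausdorff1_delta \<delta> B \<le> hausdorff1_delta \<epsilon> A + hausdorff1_delta \<epsilon> B"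
      using e by (intro add_mono hausdorff1_delta_antimono)
    also have "\<dots> \<le> hausdorff1_delta \<epsilon> (A \<union> B)" using * e by blast
    also have "\<dots> \<le> hausdorff1_outer (A \<union> B)"
      unfolding hausdorff1_outer_def using e by (intro SUP_upper) auto
    finally show "hausdorff1_delta \<delta> A + hausdorff1_delta \<delta> B \<le> hausdorff1_outer (A \<union> B)" .
  qed
  finally show ?thesis .
qed

lemma hausdorff1_outer_Un_le:
  fixes A B :: "'a::metric_space set"
  shows "hausdorff1_outer (A \<union> B) \<le> hausdorff1_outer A + hausdorff1_outer B"
proof -
  have "hausdorff1_outer (\<Union>i. binaryset A B i) \<le> (\<Sum>i. hausdorff1_outer (binaryset A B i))"
    by (rule hausdorff1_outer_countably_subadditive)
  then show ?thesis
    by (simp add: suminf_binaryset_eq UN_binaryset_eq)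
qed

text \<open>This is Caratheodory's criterion for \<open>F\<close>. The set \<open>B k\<close> has
  positive distance from \<open>F\<close>, so additivity holds for it and
  \<open>F \<inter> X\<close>. What \<open>B m\<close> misses of \<open>X - F\<close> lies in the
  shells \<open>D j\<close> with \<open>m \<le> j\<close>, and the measures of all shells form a
  convergent series, so the loss tends to 0.\<close>

lemma hausdorff1_outer_closed_split:
  fixes X F :: "'a::metric_space set"
  assumes "closed F"
  shows "hausdorff1_outer (F \<inter> X) + hausdorff1_outer (X - F) \<le> hausdorff1_outer X"
\<comment> \<open>The empty set is treated apart because \<open>infdist x {}\<close> is 0 by
  convention, which would make every \<open>B k\<close> and \<open>D k\<close> empty.\<close>
proof (cases "F = {}")
  case False
  define B where "B k = {x \<in> X. 1 / (real k + 1) \<le> infdist x F}" for k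
  define D where "D k = {x \<in> X. 1 / (real k + 2) \<le> infdist x F \<and> infdist x F < 1 / (real k + 1)}" for k
  have dist_ge: "c - c' \<le> dist x y" if "c \<le> infdist x F" "infdist y F \<le> c'" for x y c c'
    using infdist_triangle[of x F y] that by simp
  have B_le: "hausdorff1_outer (F \<inter> X) + hausdorff1_outer (B k) \<le> hausdorff1_outer X" for k
  proof -
    have "hausdorff1_outer (B k) + hausdorff1_outer (F \<inter> X) \<le> hausdorff1_outer (B k \<union> (F \<inter> X))"
    proof (rule hausdorff1_outer_separated)
      show "1 / (real k + 1) \<le> dist x y" if "x \<in> B k" "y \<in> F \<inter> X" for x y
        using dist_ge[of "1 / (real k + 1)" x y 0] that by (simp add: B_def)
    qed auto
    also have "\<dots> \<le> hausdorff1_outer X" by (intro hausdorff1_outer_mono) (auto simp: B_def)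
    finally show ?thesis by (simp add: add.commute)
  qed
  \<comment> \<open>Shells of equal parity are a positive distance apart, hence additive.\<close>
  have parity: "(\<Sum>i<n. hausdorff1_outer (D (2*i + r))) \<le> hausdorff1_outer X" for n r
  proof -
    have "(\<Sum>i<n. hausdorff1_outer (D (2*i + r))) \<le> hausdorff1_outer (\<Union>i<n. D (2*i + r))"
    proof (induction n)
      case (Suc n)
      show ?case
      proof (cases "n = 0")
        case False
        have "(\<Sum>i<Suc n. hausdorff1_outer (D (2*i + r)))
            \<le> hausdorff1_outer (\<Union>i<n. D (2*i + r)) + hausdorff1_outer (D (2*n + r))"
          using Suc by (simp add: add_right_mono)
        also have "\<dots> \<le> hausdorff1_outer ((\<Union>i<n. D (2*i + r)) \<union> D (2*n + r))"
        proof (rule hausdorff1_outer_separated)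
          \<comment> \<open>Points of earlier shells of this parity have distance at least
            \<open>1 / ?m\<close> from \<open>F\<close>, points of the new shell less than
            \<open>1 / (?m + 1)\<close>. As \<open>n\<close> is not 0, \<open>?m\<close> is positive
            and the gap is genuine; for \<open>?m = 0\<close> the value \<open>1 / 0 = 0\<close>
            would spoil it.\<close>
          let ?m = "real (2*n + r)"
          show "0 < 1 / ?m - 1 / (?m + 1)" using False by (simp add: frac_less2)
          fix x y assume "x \<in> (\<Union>i<n. D (2*i + r))" and y: "y \<in> D (2*n + r)"
          then obtain i where i: "i < n" "x \<in> D (2*i + r)" by auto
          then have "1 / ?m \<le> 1 / (real (2*i + r) + 2)"
            by (intro divide_left_mono) (auto intro!: mult_pos_pos)
          also have "\<dots> \<le> infdist x F" using i by (simp add: D_def)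
          finally show "1 / ?m - 1 / (?m + 1) \<le> dist x y"
            using y by (intro dist_ge) (auto simp: D_def)
        qed
        also have "(\<Union>i<n. D (2*i + r)) \<union> D (2*n + r) = (\<Union>i<Suc n. D (2*i + r))"
          by (auto simp: less_Suc_eq)
        finally show ?thesis .
      qed (simp add: lessThan_Suc)
    qed simp
    also have "\<dots> \<le> hausdorff1_outer X" by (intro hausdorff1_outer_mono) (auto simp: D_def)
    finally show ?thesis .
  qed
  have sum_le: "(\<Sum>i. hausdorff1_outer (D i)) \<le> hausdorff1_outer X + hausdorff1_outer X"
  proof (rule suminf_le_const)
    fix n
    have "(\<Sum>i<n. hausdorff1_outer (D i)) \<le> (\<Sum>i<2*n. hausdorff1_outer (D i))"
      by (intro sum_mono2) auto
    also have "\<dots> = (\<Sum>i<n. hausdorff1_outer (D (2*i + 0))) + (\<Sum>i<n. hausdorff1_outer (D (2*i + 1)))"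
      by (induction n) (simp_all add: algebra_simps)
    also have "\<dots> \<le> hausdorff1_outer X + hausdorff1_outer X"
      by (intro add_mono parity)
    finally show "(\<Sum>i<n. hausdorff1_outer (D i)) \<le> hausdorff1_outer X + hausdorff1_outer X" .
  qed simp
  show ?thesis
  proof (rule ennreal_le_epsilon)
    fix e :: real assume e: "0 < e" and fin: "hausdorff1_outer X < top"
    have D_fin: "(\<Sum>i. hausdorff1_outer (D i)) < top"
      using sum_le fin by (auto intro: le_less_trans)
    define r where "r i = enn2real (hausdorff1_outer (D i))" for i
    have r: "hausdorff1_outer (D i) = ennreal (r i)" "0 \<le> r i" for i
      using D_fin ennreal_suminf_lessD[of "\<lambda>i. hausdorff1_outer (D i)" top i]
      by (auto simp: r_def)
    have "summable r"
      using D_fin r by (intro summable_suminf_not_top) auto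
    then obtain m where m: "norm (\<Sum>i. r (i + m)) < e"
      using suminf_exist_split[OF e, of r] by blast
    have "X - F \<subseteq> B m \<union> (\<Union>j. D (j + m))"
    proof
      fix x assume x: "x \<in> X - F"
      then have pos: "0 < infdist x F"
        using assms False by (simp add: infdist_pos_not_in_closed)
      show "x \<in> B m \<union> (\<Union>j. D (j + m))"
      proof (cases "x \<in> B m")
        case notB: False
        let ?P = "\<lambda>k. 1 / (real k + 1) \<le> infdist x F"
        have ex: "\<exists>k. ?P k"
          using reals_Archimedean[OF pos] by (auto simp: inverse_eq_divide add.commute intro: less_imp_le)
        \<comment> \<open>By minimality \<open>x\<close> lies in the shell with index
          \<open>k - 1\<close>, and \<open>x \<notin> B m\<close> forces \<open>m < k\<close>, so
          this shell belongs to the tail.\<close>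
        define k where "k = (LEAST k. ?P k)"
        have k: "?P k" "\<And>i. i < k \<Longrightarrow> \<not> ?P i"
          using LeastI_ex[OF ex] not_less_Least[of _ ?P] by (auto simp: k_def)
        have "m < k"
        proof (rule ccontr)
          assume "\<not> m < k"
          then have "1 / (real m + 1) \<le> 1 / (real k + 1)" by (intro divide_left_mono) auto
          with k(1) notB x show False by (auto simp: B_def)
        qed
        then obtain j where j: "k = Suc (j + m)" using less_imp_Suc_add by (metis add.commute)
        then have "x \<in> D (j + m)" using k(1) k(2)[of "j + m"] x by (auto simp: D_def algebra_simps)
        then show ?thesis by blast
      qed simp
    qed
    then have "hausdorff1_outer (X - F) \<le> hausdorff1_outer (B m) + hausdorff1_outer (\<Union>j. D (j + m))"
      by (meson hausdorff1_outer_Un_le hausdorff1_outer_mono order_trans)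
    also have "hausdorff1_outer (\<Union>j. D (j + m)) \<le> (\<Sum>j. hausdorff1_outer (D (j + m)))"
      by (rule hausdorff1_outer_countably_subadditive)
    also have "\<dots> = ennreal (\<Sum>j. r (j + m))"
      unfolding r using \<open>summable r\<close> r by (intro suminf_ennreal2) (auto simp: summable_iff_shift)
    also have "\<dots> \<le> ennreal e" using m by (intro ennreal_leI) auto
    finally have "hausdorff1_outer (X - F) \<le> hausdorff1_outer (B m) + ennreal e" by simp
    then have "hausdorff1_outer (F \<inter> X) + hausdorff1_outer (X - F)
        \<le> (hausdorff1_outer (F \<inter> X) + hausdorff1_outer (B m)) + ennreal e"
      by (simp add: add.assoc add_left_mono)
    also have "\<dots> \<le> hausdorff1_outer X + ennreal e"
      by (intro add_right_mono B_le)
    finally show "hausdorff1_outer (F \<inter> X) + hausdorff1_outer (X - F) \<le> hausdorff1_outer X + ennreal e" .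
  qed
qed simp

text \<open>Closed sets belong to the lambda system of the outer measure, which is a sigma-algebra,
  so it contains all Borel sets. Hence the outer measure is countably additive on them, and
  \<open>measure_of\<close> returns it rather than its default value 0.\<close>

lemma emeasure_hausdorff1:
  fixes A :: "'a::metric_space set"
  assumes "A \<in> sets borel"
  shows "emeasure hausdorff1 A = hausdorff1_outer A"
proof -
  define L where "L = lambda_system UNIV (Pow UNIV) (hausdorff1_outer :: 'a set \<Rightarrow> ennreal)"
  have ms: "measure_space UNIV L hausdorff1_outer"
    unfolding L_def using sigma_algebra_Pow outer_measure_space_hausdorff1_outer
    by (rule sigma_algebra.caratheodory_lemma)
  then interpret L: sigma_algebra UNIV L by (simp add: measure_space_def)
  have "F \<in> L" if "closed F" for F
  proof -
    have "hausdorff1_outer (F \<inter> X) + hausdorff1_outer (- F \<inter> X) = hausdorff1_outer X" for X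
    proof (rule antisym)
      show "hausdorff1_outer (F \<inter> X) + hausdorff1_outer (- F \<inter> X) \<le> hausdorff1_outer X"
        using hausdorff1_outer_closed_split[OF that, of X] by (simp add: Diff_eq Int_commute)
      have "X = (F \<inter> X) \<union> (- F \<inter> X)" by blast
      then show "hausdorff1_outer X \<le> hausdorff1_outer (F \<inter> X) + hausdorff1_outer (- F \<inter> X)"
        by (metis hausdorff1_outer_Un_le)
    qed
    then show ?thesis by (simp add: L_def lambda_system_def Compl_eq_Diff_UNIV)
  qed
  then have "sigma_sets UNIV (Collect closed) \<subseteq> L"
    by (intro L.sigma_sets_subset) auto
  then have "sets borel \<subseteq> L" by (simp add: borel_eq_closed)
  then have "measure_space UNIV (sets (borel :: 'a measure)) hausdorff1_outer"
    using measure_down[OF ms] sets.sigma_algebra_axioms[of "borel :: 'a measure"] by simp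
  then show ?thesis
    unfolding hausdorff1_def using assms
    by (intro emeasure_measure_of_sigma) (auto simp: measure_space_def)
qed

lemma sets_hausdorff1 [simp]: "sets hausdorff1 = sets borel"
  using sets.sigma_sets_eq[of borel] by (simp add: hausdorff1_def)

lemma lborel_le_hausdorff1_outer:
  fixes f :: "'a::metric_space \<Rightarrow> real"
  assumes lip: "\<And>x y. x \<in> A \<Longrightarrow> y \<in> A \<Longrightarrow> \<bar>f x - f y\<bar> \<le> L * dist x y"
    and "0 < L" and B: "B \<in> sets borel" "B \<subseteq> f ` A"
  shows "emeasure lborel B \<le> ennreal L * hausdorff1_outer A"
proof -
  have *: "emeasure lborel B \<le> ennreal L * (\<Sum>i. ennreal (diameter (U i)))"
    if U: "A \<subseteq> (\<Union>i. U i)" "\<And>i. bounded (U i)" for U :: "nat \<Rightarrow> 'a set"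
  proof -
    define S where "S i = f ` (U i \<inter> A)" for i
    define V where "V i = (if S i = {} then {} else {Inf (S i) .. Inf (S i) + L * diameter (U i)})" for i
    have V_le: "emeasure lborel (V i) \<le> ennreal L * ennreal (diameter (U i))" for i
      using \<open>0 < L\<close> U(2)[of i] by (simp add: V_def diameter_ge_0 ennreal_mult)
    have S_V: "S i \<subseteq> V i" for i
    proof
      fix s assume s: "s \<in> S i"
      have close: "\<bar>s1 - s2\<bar> \<le> L * diameter (U i)" if s12: "s1 \<in> S i" "s2 \<in> S i" for s1 s2
      proof -
        obtain x y where "s1 = f x" "s2 = f y" "x \<in> U i" "y \<in> U i" "x \<in> A" "y \<in> A"
          using s12 by (auto simp: S_def)
        then show ?thesis
          using lip[of x y] diameter_bounded_bound[OF U(2), of x i y] \<open>0 < L\<close>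
          by (auto intro: order_trans mult_left_mono)
      qed
      have "bdd_below (S i)"
        using close[of _ s] s by (intro bdd_belowI[of _ "s - L * diameter (U i)"]) (fastforce simp: abs_le_iff)
      then have "Inf (S i) \<le> s" using s by (rule cInf_lower[rotated])
      moreover have "s - L * diameter (U i) \<le> Inf (S i)"
        using s close[of s] by (intro cInf_greatest) (fastforce simp: abs_le_iff)+
      ultimately show "s \<in> V i" using s by (auto simp: V_def)
    qed
    have "B \<subseteq> (\<Union>i. V i)"
    proof
      fix b assume "b \<in> B"
      then obtain x where x: "x \<in> A" "b = f x" using B(2) by blast
      then obtain i where "x \<in> U i" using U(1) by blast
      then have "b \<in> S i" using x by (simp add: S_def)
      then show "b \<in> (\<Union>i. V i)" using S_V by blast
    qed
    then have "emeasure lborel B \<le> emeasure lborel (\<Union>i. V i)"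
      by (intro emeasure_mono) (auto simp: V_def)
    also have "\<dots> \<le> (\<Sum>i. emeasure lborel (V i))"
      by (intro emeasure_subadditive_countably) (auto simp: V_def)
    also have "\<dots> \<le> (\<Sum>i. ennreal L * ennreal (diameter (U i)))"
      by (intro suminf_le V_le) auto
    finally show ?thesis by simp
  qed
  have inv: "ennreal (1 / L) * (ennreal L * z) = z" "ennreal L * (ennreal (1 / L) * z) = z" for z
    using \<open>0 < L\<close> by (simp_all add: mult.assoc[symmetric] ennreal_mult[symmetric])
  \<comment> \<open>The estimate holds for covers of every mesh, so mesh 1 serves as a lower bound
    for the supremum. Dividing by \<open>L\<close> first leaves the infimum over covers alone on the
    right.\<close>
  have "ennreal (1 / L) * emeasure lborel B \<le> hausdorff1_delta 1 A"
  proof (rule hausdorff1_delta_geI)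
    fix U :: "nat \<Rightarrow> 'a set" assume "A \<subseteq> (\<Union>i. U i)" "\<And>i. bounded (U i)"
    from mult_left_mono[OF *[OF this], of "ennreal (1 / L)"]
    show "ennreal (1 / L) * emeasure lborel B \<le> (\<Sum>i. ennreal (diameter (U i)))"
      by (simp add: inv)
  qed
  also have "\<dots> \<le> hausdorff1_outer A"
    unfolding hausdorff1_outer_def by (intro SUP_upper) auto
  finally have "ennreal L * (ennreal (1 / L) * emeasure lborel B) \<le> ennreal L * hausdorff1_outer A"
    by (rule mult_left_mono) simp
  then show ?thesis by (simp only: inv)
qed

subsection \<open>Overlapping intervals\<close>

text \<open>Cauchy-Schwarz for the function \<open>N\<close> that counts the intervals containing a
  point: it is supported on the union, its integral is \<open>card Q * h\<close>, and the integral
  of its square is at most \<open>h\<close> times the number of pairs of intervals that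
  meet.\<close>

lemma card_sq_le_overlap_mult_measure_Union:
  fixes \<sigma> :: "'a \<Rightarrow> real"
  assumes "finite Q" and "0 < h"
  shows "(real (card Q))\<^sup>2 * h \<le> real (card {(p, q) \<in> Q \<times> Q. \<bar>\<sigma> p - \<sigma> q\<bar> \<le> h}) *
           measure lborel (\<Union>q\<in>Q. {\<sigma> q .. \<sigma> q + h})"
proof (cases "Q = {}")
  case False
  define I where "I q = {\<sigma> q .. \<sigma> q + h}" for q
  define U where "U = (\<Union>q\<in>Q. I q)"
  define P where "P = {(p, q) \<in> Q \<times> Q. \<bar>\<sigma> p - \<sigma> q\<bar> \<le> h}"
  define M where "M = real (card P)"
  define N where "N x = (\<Sum>q\<in>Q. indicator (I q) x :: real)" for x
  have U_fin: "emeasure lborel U < \<infinity>"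
  proof -
    have "emeasure lborel U \<le> (\<Sum>q\<in>Q. emeasure lborel (I q))"
      unfolding U_def using assms by (intro emeasure_subadditive_finite) (auto simp: I_def)
    also have "\<dots> < \<infinity>" using assms by (simp add: I_def less_top[symmetric] ennreal_mult_eq_top_iff)
    finally show ?thesis .
  qed
  have U_meas: "U \<in> sets lborel" using assms by (auto simp: U_def I_def)
  have int_U: "integrable lborel (indicator U :: real \<Rightarrow> real)"
    using U_fin U_meas by simp
  have int_I: "integrable lborel (indicator (I p \<inter> I q) :: real \<Rightarrow> real)" for p q
    by (intro integrable_real_indicator) (simp_all add: I_def emeasure_lborel_Icc_eq)
  have P: "finite P" "P \<subseteq> Q \<times> Q" using assms by (auto simp: P_def intro: finite_subset[of _ "Q \<times> Q"])
  have "(\<lambda>q. (q, q)) ` Q \<subseteq> P" using assms by (auto simp: P_def)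
  then have "P \<noteq> {}" using False by auto
  then have M: "0 < M" using P by (simp add: M_def card_gt_0_iff)
  have Q: "0 < real (card Q)" using False assms by (simp add: card_gt_0_iff)
  \<comment> \<open>Cauchy-Schwarz is carried out through the pointwise inequality
    \<open>2 * l * N x \<le> (N x)^2 + l^2\<close> on the union. The best \<open>l\<close> is the
    bound \<open>M * h\<close> for the integral of the square divided by the integral
    \<open>card Q * h\<close> of \<open>N\<close>.\<close>
  define l where "l = M / real (card Q)"
  have sq: "(N x)\<^sup>2 = (\<Sum>p\<in>Q. \<Sum>q\<in>Q. indicator (I p \<inter> I q) x)" for x
    by (simp add: N_def power2_eq_square sum_product indicator_inter_arith)
  have "2 * l * (real (card Q) * h) = (\<integral>x. 2 * l * N x \<partial>lborel)"
    using int_I[of q q for q] assms unfolding N_def by (simp add: I_def)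
  also have "\<dots> \<le> (\<integral>x. (\<Sum>p\<in>Q. \<Sum>q\<in>Q. indicator (I p \<inter> I q) x) + l\<^sup>2 * indicator U x \<partial>lborel)"
  proof (rule integral_mono)
    show "integrable lborel (\<lambda>x. 2 * l * N x)"
      using int_I[of q q for q] unfolding N_def by (intro integrable_mult_right Bochner_Integration.integrable_sum) simp
    show "integrable lborel (\<lambda>x. (\<Sum>p\<in>Q. \<Sum>q\<in>Q. indicator (I p \<inter> I q) x) + l\<^sup>2 * indicator U x)"
      by (intro Bochner_Integration.integrable_add integrable_mult_right Bochner_Integration.integrable_sum int_I int_U)
    fix x
    show "2 * l * N x \<le> (\<Sum>p\<in>Q. \<Sum>q\<in>Q. indicator (I p \<inter> I q) x) + l\<^sup>2 * indicator U x"
    proof (cases "x \<in> U")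
      case True
      then show ?thesis
        using zero_le_power2[of "N x - l"] by (simp add: sq[symmetric] power2_diff algebra_simps)
    next
      case False
      then have "N x = 0" by (auto simp: N_def U_def intro!: sum.neutral)
      then show ?thesis by (simp add: sq[symmetric])
    qed
  qed
  also have "\<dots> = (\<Sum>p\<in>Q. \<Sum>q\<in>Q. measure lborel (I p \<inter> I q)) + l\<^sup>2 * measure lborel U"
    using int_I int_U by (simp add: Bochner_Integration.integral_sum)
  also have "(\<Sum>p\<in>Q. \<Sum>q\<in>Q. measure lborel (I p \<inter> I q)) \<le> M * h"
  proof -
    have "measure lborel (I p \<inter> I q) \<le> (if (p, q) \<in> P then h else 0)" if "p \<in> Q" "q \<in> Q" for p q
    proof (cases "(p, q) \<in> P")
      case True
      have "measure lborel (I p \<inter> I q) \<le> measure lborel (I p)"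
        by (intro measure_mono_fmeasurable) (auto simp: I_def fmeasurable_def emeasure_lborel_Icc_eq)
      with True assms show ?thesis by (simp add: I_def)
    next
      case False
      then have "I p \<inter> I q = {}" using that by (auto simp: I_def P_def)
      with False show ?thesis by simp
    qed
    then have "(\<Sum>p\<in>Q. \<Sum>q\<in>Q. measure lborel (I p \<inter> I q)) \<le> (\<Sum>p\<in>Q. \<Sum>q\<in>Q. if (p, q) \<in> P then h else 0)"
      by (intro sum_mono) auto
    also have "\<dots> = (\<Sum>z\<in>Q \<times> Q. if z \<in> P then h else 0)"
      by (simp add: sum.cartesian_product)
    also have "\<dots> = (\<Sum>z\<in>P. h)"
      using assms P by (intro sum.mono_neutral_cong_right) auto
    finally show ?thesis by (simp add: M_def)
  qed
  finally have "2 * (M * h) \<le> M * h + l\<^sup>2 * measure lborel U"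
    using Q by (simp add: l_def field_simps)
  then have "M * h \<le> (M / real (card Q))\<^sup>2 * measure lborel U" by (simp add: l_def)
  then have "M * ((real (card Q))\<^sup>2 * h) \<le> M * (M * measure lborel U)"
    using Q by (simp add: field_simps power2_eq_square)
  then have "(real (card Q))\<^sup>2 * h \<le> M * measure lborel U"
    using M by simp
  then show ?thesis by (simp add: M_def P_def U_def I_def)
qed simp

subsection \<open>The four corner Cantor set\<close>

text \<open>These are the translation vectors of the four similarities
  \<open>x \<mapsto> d + x / 4\<close> that generate the Cantor set.\<close>

definition first_corners :: "(real^2) set" where
  "first_corners = (\<lambda>(i, j). (1/4) *\<^sub>R vector [i, j]) ` ({0, 3} \<times> {0, 3})"

text \<open>The defining recursion refines at the smallest scale. This is the self-similar form,
  which splits at the largest scale and is the one that inductions on the energy and on distances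
  need. Both agree because adding the last digit commutes with the outer similarity.\<close>

lemma mem_cantor_corners_Suc:
  "x \<in> cantor_corners (Suc n) \<longleftrightarrow> (\<exists>d\<in>first_corners. \<exists>p\<in>cantor_corners n. x = d + (1/4) *\<^sub>R p)"
proof (induction n arbitrary: x)
  case 0
  show ?case
    by (auto simp: first_corners_def)
next
  case (Suc n)
  have mem_Suc: "x \<in> cantor_corners (Suc m) \<longleftrightarrow>
      (\<exists>p\<in>cantor_corners m. \<exists>i\<in>{0, 3}. \<exists>j\<in>{0, 3}. x = p + ((1/4)^m / 4) *\<^sub>R vector [i, j])" for x m
    by auto
  have shift: "d + (1/4) *\<^sub>R p + ((1/4)^Suc n / 4) *\<^sub>R v = d + (1/4) *\<^sub>R (p + ((1/4)^n / 4) *\<^sub>R v)"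
    for d p v :: "real^2"
    by (simp add: algebra_simps)
  have "x \<in> cantor_corners (Suc (Suc n)) \<longleftrightarrow> (\<exists>d\<in>first_corners. \<exists>p\<in>cantor_corners n.
      \<exists>i\<in>{0, 3}. \<exists>j\<in>{0, 3}. x = d + (1/4) *\<^sub>R p + ((1/4)^Suc n / 4) *\<^sub>R vector [i, j])"
    unfolding mem_Suc[of _ "Suc n"] Bex_def Suc.IH by metis
  also have "\<dots> \<longleftrightarrow> (\<exists>d\<in>first_corners. \<exists>p\<in>cantor_corners (Suc n). x = d + (1/4) *\<^sub>R p)"
    unfolding shift mem_Suc[of _ n] Bex_def by metis
  finally show ?case .
qed

lemma cantor_corners_Suc_eq_image:
  "cantor_corners (Suc n) = (\<lambda>z. fst z + (1/4) *\<^sub>R snd z) ` (first_corners \<times> cantor_corners n)"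
  unfolding set_eq_iff mem_cantor_corners_Suc by force

lemma first_corners_nth: "d \<in> first_corners \<Longrightarrow> d $ i = 0 \<or> d $ i = 3/4"
  using exhaust_2[of i] by (auto simp: first_corners_def)

lemma card_first_corners: "card first_corners = 4"
proof -
  have "inj_on (\<lambda>(i, j). (1/4) *\<^sub>R vector [i, j] :: real^2) ({0, 3} \<times> {0, 3})"
    by (auto simp: inj_on_def vec_eq_iff forall_2)
  then show ?thesis by (simp add: first_corners_def card_image card_cartesian_product)
qed

lemma finite_first_corners: "finite first_corners"
  by (simp add: first_corners_def)

lemma finite_cantor_corners: "finite (cantor_corners n)"
  by (induction n) (simp_all add: cantor_corners_Suc_eq_image finite_first_corners del: cantor_corners.simps(2))

text \<open>The upper bound leaves room for the side \<open>(1/4)^n\<close>, so that the whole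
  square with this corner stays in the unit square.\<close>

lemma cantor_corners_nth:
  "p \<in> cantor_corners n \<Longrightarrow> 0 \<le> p $ i \<and> p $ i \<le> 1 - (1/4)^n"
proof (induction n arbitrary: p)
  case (Suc n)
  from Suc.prems obtain d p' where "d \<in> first_corners" "p' \<in> cantor_corners n" "p = d + (1/4) *\<^sub>R p'"
    unfolding mem_cantor_corners_Suc by blast
  with Suc.IH[of p'] first_corners_nth[of d i] show ?case by auto
qed simp

text \<open>In some coordinate \<open>d\<close> and \<open>d'\<close> differ by \<open>3/4\<close>,
  while \<open>p / 4\<close> and \<open>p' / 4\<close> differ there by at most
  \<open>1/4\<close>.\<close>

lemma first_corners_separated:
  assumes "d \<in> first_corners" "d' \<in> first_corners" "d \<noteq> d'"
    and "p \<in> cantor_corners n" "p' \<in> cantor_corners n"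
  shows "1/2 \<le> norm ((d + (1/4) *\<^sub>R p) - (d' + (1/4) *\<^sub>R p'))"
proof -
  obtain i where i: "d $ i \<noteq> d' $ i" using assms(3) by (auto simp: vec_eq_iff)
  then have "d $ i - d' $ i = 3/4 \<or> d $ i - d' $ i = - 3/4"
    using first_corners_nth[OF assms(1), of i] first_corners_nth[OF assms(2), of i] by auto
  moreover have "\<bar>p $ i - p' $ i\<bar> \<le> 1"
    using cantor_corners_nth[OF assms(4), of i] cantor_corners_nth[OF assms(5), of i]
      zero_le_power[of "1/4::real" n] by linarith
  moreover have "((d + (1/4) *\<^sub>R p) - (d' + (1/4) *\<^sub>R p')) $ i = (d $ i - d' $ i) + (p $ i - p' $ i) / 4"
    by (simp add: field_simps)
  moreover have "1/2 \<le> \<bar>z\<bar>" if "a = 3/4 \<or> a = - 3/4" "\<bar>b\<bar> \<le> 1" "z = a + b / 4" for a b z :: real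
    using that by (elim disjE) linarith+
  ultimately have "1/2 \<le> \<bar>((d + (1/4) *\<^sub>R p) - (d' + (1/4) *\<^sub>R p')) $ i\<bar>"
    by blast
  also have "\<dots> \<le> norm ((d + (1/4) *\<^sub>R p) - (d' + (1/4) *\<^sub>R p'))"
    by (rule component_le_norm_cart)
  finally show ?thesis .
qed

lemma inj_on_cantor_corners_Suc:
  "inj_on (\<lambda>z. fst z + (1/4) *\<^sub>R snd z) (first_corners \<times> cantor_corners n)"
proof (rule inj_onI, clarsimp)
  fix d d' p p' :: "real^2"
  assume *: "d \<in> first_corners" "d' \<in> first_corners" "p \<in> cantor_corners n" "p' \<in> cantor_corners n"
    "d + (1/4) *\<^sub>R p = d' + (1/4) *\<^sub>R p'"
  then have "d = d'" using first_corners_separated[of d d' p n p'] by fastforce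
  with * show "d = d' \<and> p = p'" by simp
qed

lemma card_cantor_corners: "card (cantor_corners n) = 4 ^ n"
  by (induction n)
    (simp_all add: cantor_corners_Suc_eq_image card_image inj_on_cantor_corners_Suc
      card_cartesian_product card_first_corners del: cantor_corners.simps(2))

text \<open>The diagonal terms are \<open>1 / 0 = 0\<close>.\<close>

lemma cantor_corners_energy:
  "(\<Sum>p\<in>cantor_corners n. \<Sum>q\<in>cantor_corners n. 1 / norm (p - q)) \<le> 2 * real n * 16 ^ n"
proof (induction n)
  case (Suc n)
  let ?C = "cantor_corners n" and ?D = first_corners
  have sum_g: "(\<Sum>x\<in>cantor_corners (Suc n). F x) = (\<Sum>d\<in>?D. \<Sum>p\<in>?C. F (d + (1/4) *\<^sub>R p))"
    for F :: "real^2 \<Rightarrow> real"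
    unfolding cantor_corners_Suc_eq_image sum.reindex[OF inj_on_cantor_corners_Suc]
    by (simp add: sum.cartesian_product case_prod_unfold)
  \<comment> \<open>Within one first-generation square distances shrink by 4, so the kernel grows by
    4; points of different ones are at least \<open>1/2\<close> apart and contribute at most 2.
    Adding 2 in both cases makes the sum easy to evaluate.\<close>
  have term_le: "1 / norm ((d + (1/4) *\<^sub>R p) - (d' + (1/4) *\<^sub>R p'))
      \<le> (if d = d' then 4 * (1 / norm (p - p')) else 0) + 2"
    if "d \<in> ?D" "d' \<in> ?D" "p \<in> ?C" "p' \<in> ?C" for d d' p p'
  proof (cases "d = d'")
    case True
    have "(d + (1/4) *\<^sub>R p) - (d' + (1/4) *\<^sub>R p') = (1/4) *\<^sub>R (p - p')"
      using True by (simp add: algebra_simps)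
    then have "norm ((d + (1/4) *\<^sub>R p) - (d' + (1/4) *\<^sub>R p')) = norm (p - p') / 4"
      by (simp only: norm_scaleR)
    then have "1 / norm ((d + (1/4) *\<^sub>R p) - (d' + (1/4) *\<^sub>R p')) = 4 * (1 / norm (p - p'))"
      by (simp only: divide_divide_eq_right)
    with True show ?thesis by simp
  next
    case False
    then have "1 / norm ((d + (1/4) *\<^sub>R p) - (d' + (1/4) *\<^sub>R p')) \<le> 1 / (1/2)"
      using first_corners_separated[of d d' p n p'] that by (intro divide_left_mono) auto
    with False show ?thesis by simp
  qed
  have "(\<Sum>x\<in>cantor_corners (Suc n). \<Sum>y\<in>cantor_corners (Suc n). 1 / norm (x - y))
      = (\<Sum>d\<in>?D. \<Sum>p\<in>?C. \<Sum>d'\<in>?D. \<Sum>p'\<in>?C. 1 / norm ((d + (1/4) *\<^sub>R p) - (d' + (1/4) *\<^sub>R p')))"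
    by (simp only: sum_g)
  also have "\<dots> \<le> (\<Sum>d\<in>?D. \<Sum>p\<in>?C. \<Sum>d'\<in>?D. \<Sum>p'\<in>?C. (if d = d' then 4 * (1 / norm (p - p')) else 0) + 2)"
    by (intro sum_mono term_le)
  also have "\<dots> = (\<Sum>d\<in>?D. \<Sum>p\<in>?C. 4 * (\<Sum>p'\<in>?C. 1 / norm (p - p')) + 8 * 4 ^ n)"
  proof (intro sum.cong refl)
    fix d p assume "d \<in> ?D"
    have "(\<Sum>d'\<in>?D. \<Sum>p'\<in>?C. (if d = d' then 4 * (1 / norm (p - p')) else 0) + 2)
        = (\<Sum>d'\<in>?D. (if d = d' then 4 * (\<Sum>p'\<in>?C. 1 / norm (p - p')) else 0) + 2 * 4 ^ n)"
      by (intro sum.cong refl) (simp add: sum.distrib card_cantor_corners sum_distrib_left)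
    also have "\<dots> = 4 * (\<Sum>p'\<in>?C. 1 / norm (p - p')) + 8 * 4 ^ n"
      unfolding sum.distrib using \<open>d \<in> ?D\<close> card_first_corners finite_first_corners by (subst sum.delta') simp_all
    finally show "(\<Sum>d'\<in>?D. \<Sum>p'\<in>?C. (if d = d' then 4 * (1 / norm (p - p')) else 0) + 2)
        = 4 * (\<Sum>p'\<in>?C. 1 / norm (p - p')) + 8 * 4 ^ n" .
  qed
  \<comment> \<open>After division by \<open>16 ^ n\<close> the energy thus grows by at most 2 per
    generation, which is the source of the linear factor \<open>n\<close>.\<close>
  also have "\<dots> = 16 * (\<Sum>p\<in>?C. \<Sum>p'\<in>?C. 1 / norm (p - p')) + 2 * 16 ^ Suc n"
    using card_first_corners
    by (simp add: sum.distrib card_cantor_corners sum_distrib_left power_mult_distrib[symmetric])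
  also have "\<dots> \<le> 16 * (2 * real n * 16 ^ n) + 2 * 16 ^ Suc n"
    using Suc by simp
  also have "\<dots> = 2 * real (Suc n) * 16 ^ Suc n" by (simp add: algebra_simps)
  finally show ?case .
qed simp

lemma cantor_corners_subset_square: "p \<in> cantor_corners n \<Longrightarrow> square p ((1/4)^n) \<subseteq> square 0 1"
  using cantor_corners_nth[of p n] unfolding square_def
  by (auto simp: mem_box_cart forall_2) (smt (verit))+

subsection \<open>Slopes\<close>

text \<open>For orthonormal \<open>e\<close> and \<open>f\<close> this is the tangent of the angle
  from \<open>f\<close> to \<open>x - a\<close>, counted towards \<open>e\<close>. It depends on the
  direction of \<open>x - a\<close> only.\<close>

definition slope :: "real^2 \<Rightarrow> real^2 \<Rightarrow> real^2 \<Rightarrow> real^2 \<Rightarrow> real" where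
  "slope e f a x = ((x - a) \<bullet> e) / ((x - a) \<bullet> f)"

text \<open>In orthonormal coordinates the numerator is the determinant of \<open>x - a\<close> and
  \<open>y - x\<close>; it vanishes exactly when \<open>a\<close>, \<open>x\<close>,
  \<open>y\<close> are collinear.\<close>

lemma slope_diff:
  assumes "(x - a) \<bullet> f \<noteq> 0" "(y - a) \<bullet> f \<noteq> 0"
  shows "slope e f a x - slope e f a y =
    (((x - a) \<bullet> e) * ((y - x) \<bullet> f) - ((y - x) \<bullet> e) * ((x - a) \<bullet> f)) / (((x - a) \<bullet> f) * ((y - a) \<bullet> f))"
  using assms by (simp add: slope_def field_simps inner_diff_left)

text \<open>The slope factors through \<open>radial_proj\<close>. On unit vectors \<open>u\<close>
  with \<open>k / R \<le> u \<bullet> f\<close> the quotient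
  \<open>(u \<bullet> e) / (u \<bullet> f)\<close> is Lipschitz: the numerator of a difference is at
  most \<open>2 * dist u u'\<close>, the denominator at least \<open>(k / R)^2\<close>.\<close>

lemma lborel_le_vis:
  assumes e: "norm e = 1" and f: "norm f = 1" and "0 < k" "0 < R"
    and S: "\<And>x. x \<in> S \<Longrightarrow> k \<le> (x - a) \<bullet> f" "\<And>x. x \<in> S \<Longrightarrow> norm (x - a) \<le> R"
    and B: "B \<in> sets borel" "B \<subseteq> slope e f a ` S"
  shows "emeasure lborel B \<le> ennreal (2 * R\<^sup>2 / k\<^sup>2) * vis a S"
  unfolding vis_def
proof (rule lborel_le_hausdorff1_outer[where f = "\<lambda>u. (u \<bullet> e) / (u \<bullet> f)"])
  show "0 < 2 * R\<^sup>2 / k\<^sup>2" using assms by simp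
  have pos: "x \<noteq> a" "0 < norm (x - a)" if "x \<in> S" for x
    using S(1)[OF that] \<open>0 < k\<close> by auto
  show "B \<subseteq> (\<lambda>u. (u \<bullet> e) / (u \<bullet> f)) ` radial_proj a ` (S - {a})"
  proof
    fix b assume "b \<in> B"
    then obtain x where x: "x \<in> S" "b = slope e f a x" using B by blast
    then have "b = (radial_proj a x \<bullet> e) / (radial_proj a x \<bullet> f)"
      using pos[of x] by (simp add: slope_def radial_proj_def)
    with x pos show "b \<in> (\<lambda>u. (u \<bullet> e) / (u \<bullet> f)) ` radial_proj a ` (S - {a})" by blast
  qed
  fix u u' assume u: "u \<in> radial_proj a ` (S - {a})" "u' \<in> radial_proj a ` (S - {a})"
  have *: "norm u = 1 \<and> k / R \<le> u \<bullet> f" if u: "u \<in> radial_proj a ` (S - {a})" for u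
  proof -
    obtain x where x: "x \<in> S" "u = (x - a) /\<^sub>R norm (x - a)" using u by (auto simp: radial_proj_def)
    have "k / R \<le> (x - a) \<bullet> f / norm (x - a)"
      using S(1)[OF x(1)] S(2)[OF x(1)] pos[OF x(1)] \<open>0 < k\<close> by (intro frac_le) linarith+
    with x pos[of x] show ?thesis by (simp add: divide_inverse mult.commute)
  qed
  have t: "0 < k / R" using assms by simp
  let ?n = "(u \<bullet> e) * ((u' - u) \<bullet> f) - ((u' - u) \<bullet> e) * (u \<bullet> f)"
  have "\<bar>?n\<bar> \<le> \<bar>u \<bullet> e\<bar> * \<bar>(u' - u) \<bullet> f\<bar> + \<bar>(u' - u) \<bullet> e\<bar> * \<bar>u \<bullet> f\<bar>"
    by (metis abs_mult abs_triangle_ineq4)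
  also have "\<dots> \<le> 1 * norm (u' - u) + norm (u' - u) * 1"
    using *[OF u(1)] e f Cauchy_Schwarz_ineq2[of u e] Cauchy_Schwarz_ineq2[of u f]
      Cauchy_Schwarz_ineq2[of "u' - u" e] Cauchy_Schwarz_ineq2[of "u' - u" f]
    by (intro add_mono mult_mono) auto
  finally have n: "\<bar>?n\<bar> \<le> 2 * dist u u'" by (simp add: dist_norm norm_minus_commute)
  have "(k / R)\<^sup>2 \<le> (u \<bullet> f) * (u' \<bullet> f)"
    unfolding power2_eq_square using t *[OF u(1)] *[OF u(2)] by (intro mult_mono) auto
  then have "\<bar>?n\<bar> / ((u \<bullet> f) * (u' \<bullet> f)) \<le> (2 * dist u u') / (k / R)\<^sup>2"
    using n t by (intro frac_le) auto
  moreover have "(u \<bullet> e) / (u \<bullet> f) - (u' \<bullet> e) / (u' \<bullet> f) = ?n / ((u \<bullet> f) * (u' \<bullet> f))"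
    using t *[OF u(1)] *[OF u(2)] by (simp add: field_simps inner_diff_left)
  moreover have "0 < (u \<bullet> f) * (u' \<bullet> f)"
    using t *[OF u(1)] *[OF u(2)] by (intro mult_pos_pos) auto
  ultimately show "\<bar>(u \<bullet> e) / (u \<bullet> f) - (u' \<bullet> e) / (u' \<bullet> f)\<bar> \<le> 2 * R\<^sup>2 / k\<^sup>2 * dist u u'"
    by (simp only: abs_divide abs_of_pos) (simp add: power_divide algebra_simps)
qed (use B in auto)

text \<open>Moving from the centre \<open>q\<close> by \<open>r\<close> along the unit vector
  \<open>e\<close>, with \<open>0 \<le> r \<le> s / 2\<close>, stays in the square. It keeps the
  denominator of the slope, since \<open>e\<close> and \<open>f\<close> are orthogonal, and raises
  the slope by \<open>r / ((q - a) \<bullet> f)\<close>.\<close>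

lemma Icc_subset_slope_square:
  assumes e: "norm e = 1" "e \<bullet> f = 0" and "0 \<le> s"
    and q: "q = p + (s / 2) *\<^sub>R vector [1, 1]" "0 < (q - a) \<bullet> f" "(q - a) \<bullet> f \<le> R"
  shows "{slope e f a q .. slope e f a q + s / (2 * R)} \<subseteq> slope e f a ` square p s"
proof
  fix u assume u: "u \<in> {slope e f a q .. slope e f a q + s / (2 * R)}"
  define r where "r = (u - slope e f a q) * ((q - a) \<bullet> f)"
  have "0 \<le> r" using u q by (simp add: r_def)
  have "r \<le> (s / (2 * R)) * R"
    unfolding r_def using u q \<open>0 \<le> s\<close> by (intro mult_mono) auto
  then have "r \<le> s / 2" using q by simp
  have "e \<bullet> e = 1" using e by (simp add: norm_eq_1)
  have "\<bar>(r *\<^sub>R e) $ i\<bar> \<le> s / 2" for i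
    using component_le_norm_cart[of "r *\<^sub>R e" i] \<open>0 \<le> r\<close> \<open>r \<le> s / 2\<close> e by simp
  from this[of 1] this[of 2] have "q + r *\<^sub>R e \<in> square p s"
    unfolding square_def mem_box_cart q(1) forall_2 by (simp add: abs_le_iff) linarith
  moreover have "slope e f a (q + r *\<^sub>R e) = u"
  proof -
    have "slope e f a (q + r *\<^sub>R e) = ((q - a) \<bullet> e + r) / ((q - a) \<bullet> f)"
      using e \<open>e \<bullet> e = 1\<close> by (simp add: slope_def inner_diff_left inner_add_left algebra_simps)
    also have "\<dots> = slope e f a q + (u - slope e f a q)"
      using q by (simp add: slope_def r_def add_divide_distrib)
    finally show ?thesis by simp
  qed
  ultimately show "u \<in> slope e f a ` square p s" by blast
qed

text \<open>Close slopes force the determinant \<open>g t\<close> of \<open>x - \<gamma> t\<close>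
  and \<open>w = y - x\<close> to be small. If \<open>w\<close> has a substantial component along
  \<open>f\<close>, then \<open>g\<close> moves at a definite speed along the arc and is small only
  on a short interval, which gives the first term. Otherwise \<open>w\<close> is nearly parallel to
  \<open>e\<close> and \<open>g\<close> is comparable to \<open>norm w\<close>, so close slopes
  occur only if \<open>h / norm w\<close> is not small; the full length of the parameter interval
  then gives the second term.\<close>

lemma measure_close_slopes_le:
  fixes \<gamma> :: "real \<Rightarrow> real^2"
  assumes e: "norm e = 1" and f: "norm f = 1" and ef: "\<And>z::real^2. norm z \<le> \<bar>z \<bullet> e\<bar> + \<bar>z \<bullet> f\<bar>"
    and orth: "e \<bullet> f = 0" and "\<alpha> < \<beta>" "0 < k" "0 < R" "0 < \<nu>" "0 < h"
    and chord: "\<And>s t. s \<in> {\<alpha>..\<beta>} \<Longrightarrow> t \<in> {\<alpha>..\<beta>} \<Longrightarrow>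
        norm (\<gamma> t - \<gamma> s - ((t - s) * \<nu>) *\<^sub>R e) \<le> (\<nu> * k / (16 * R)) * \<bar>t - s\<bar>"
    and x: "\<And>t. t \<in> {\<alpha>..\<beta>} \<Longrightarrow> k \<le> (x - \<gamma> t) \<bullet> f \<and> norm (x - \<gamma> t) \<le> R"
    and y: "\<And>t. t \<in> {\<alpha>..\<beta>} \<Longrightarrow> k \<le> (y - \<gamma> t) \<bullet> f \<and> norm (y - \<gamma> t) \<le> R"
    and "x \<noteq> y"
    and A: "A = {t \<in> {\<alpha>..\<beta>}. \<bar>slope e f (\<gamma> t) x - slope e f (\<gamma> t) y\<bar> \<le> h}" "A \<in> sets lborel"
  shows "measure lborel A \<le> (32 * R^3 / (\<nu> * k) + 2 * R\<^sup>2 * (\<beta> - \<alpha>) / k) * h / norm (x - y)"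
proof -
  define w where "w = y - x"
  define n where "n = norm w"
  \<comment> \<open>With this threshold the term \<open>R * \<eta> * n\<close> in the second case is
    only \<open>k * n / 4\<close>, and the constant in the chord hypothesis becomes
    \<open>\<nu> * \<eta> / 4\<close>.\<close>
  define \<eta> where "\<eta> = k / (4 * R)"
  define g where "g t = ((x - \<gamma> t) \<bullet> e) * (w \<bullet> f) - (w \<bullet> e) * ((x - \<gamma> t) \<bullet> f)" for t
  have n: "0 < n" "norm (x - y) = n" using \<open>x \<noteq> y\<close> by (simp_all add: n_def w_def norm_minus_commute)
  have inner_e: "\<bar>z \<bullet> e\<bar> \<le> norm z" and inner_f: "\<bar>z \<bullet> f\<bar> \<le> norm z" for z
    using Cauchy_Schwarz_ineq2[of z e] Cauchy_Schwarz_ineq2[of z f] e f by auto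
  have "k \<le> R" using x[of \<alpha>] \<open>\<alpha> < \<beta>\<close> inner_f[of "x - \<gamma> \<alpha>"] by auto
  then have \<eta>: "0 < \<eta>" "\<eta> \<le> 1/4" using \<open>0 < k\<close> \<open>0 < R\<close> by (simp_all add: \<eta>_def)
  have g_le: "\<bar>g t\<bar> \<le> h * R\<^sup>2" if "t \<in> A" for t
  proof -
    have t: "t \<in> {\<alpha>..\<beta>}" and *: "\<bar>slope e f (\<gamma> t) x - slope e f (\<gamma> t) y\<bar> \<le> h" using that A by auto
    let ?p = "((x - \<gamma> t) \<bullet> f) * ((y - \<gamma> t) \<bullet> f)"
    have p: "0 < (x - \<gamma> t) \<bullet> f" "0 < (y - \<gamma> t) \<bullet> f" using x[OF t] y[OF t] \<open>0 < k\<close> by auto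
    then have "\<bar>g t\<bar> = \<bar>slope e f (\<gamma> t) x - slope e f (\<gamma> t) y\<bar> * ?p"
      using slope_diff[of x "\<gamma> t" f y e] by (simp add: g_def w_def abs_mult)
    also have "\<dots> \<le> h * (R * R)"
      using * p x[OF t] y[OF t] inner_f[of "x - \<gamma> t"] inner_f[of "y - \<gamma> t"] \<open>0 < h\<close> \<open>0 < R\<close>
      by (intro mult_mono) auto
    finally show ?thesis by (simp add: power2_eq_square)
  qed
  have first_nonneg: "0 \<le> 32 * R^3 / (\<nu> * k) * h / n" "0 \<le> 2 * R\<^sup>2 * (\<beta> - \<alpha>) / k * h / n"
    using assms n by auto
  have "measure lborel A \<le> 32 * R^3 / (\<nu> * k) * h / n + 2 * R\<^sup>2 * (\<beta> - \<alpha>) / k * h / n"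
  proof (cases "A = {}")
    case False
    then obtain s where s: "s \<in> A" by blast
    then have s': "s \<in> {\<alpha>..\<beta>}" using A by auto
    show ?thesis
    \<comment> \<open>Either the derivative of \<open>g\<close> or \<open>g\<close> itself is bounded below by a multiple of \<open>n\<close>.\<close>
    proof (cases "\<eta> * n \<le> \<bar>w \<bullet> f\<bar>")
      case True
      define d where "d = 4 * h * R\<^sup>2 / (\<nu> * \<eta> * n)"
      have "\<bar>t - s\<bar> \<le> d" if t: "t \<in> A" for t
      proof -
        have t': "t \<in> {\<alpha>..\<beta>}" using t A by auto
        define \<Delta> where "\<Delta> = \<gamma> t - \<gamma> s - ((t - s) * \<nu>) *\<^sub>R e"
        have "norm \<Delta> \<le> (\<nu> * \<eta> / 4) * \<bar>t - s\<bar>"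
          using chord[OF s' t'] by (simp add: \<Delta>_def \<eta>_def mult.assoc)
        then have \<Delta>: "\<bar>\<Delta> \<bullet> e\<bar> \<le> (\<nu> * \<eta> / 4) * \<bar>t - s\<bar>" "\<bar>\<Delta> \<bullet> f\<bar> \<le> (\<nu> * \<eta> / 4) * \<bar>t - s\<bar>"
          using inner_e[of \<Delta>] inner_f[of \<Delta>] by auto
        have De: "\<Delta> \<bullet> e = \<gamma> t \<bullet> e - \<gamma> s \<bullet> e - (t - s) * \<nu>" "\<Delta> \<bullet> f = \<gamma> t \<bullet> f - \<gamma> s \<bullet> f"
          using e orth by (simp_all add: \<Delta>_def inner_diff_left norm_eq_1)
        \<comment> \<open>As \<open>g\<close> is affine in the position on the arc, linear motion
          along \<open>e\<close> contributes exactly the first summand. The two error terms together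
          take at most half of it when
          \<open>\<eta> * n \<le> \<bar>w \<bullet> f\<bar>\<close>.\<close>
        have "g s - g t = ((t - s) * \<nu>) * (w \<bullet> f) + ((\<Delta> \<bullet> e) * (w \<bullet> f) - (w \<bullet> e) * (\<Delta> \<bullet> f))"
          by (simp only: g_def De) (simp add: inner_diff_left algebra_simps)
        then have "\<bar>((t - s) * \<nu>) * (w \<bullet> f)\<bar>
            \<le> \<bar>g s\<bar> + \<bar>g t\<bar> + \<bar>(\<Delta> \<bullet> e) * (w \<bullet> f)\<bar> + \<bar>(w \<bullet> e) * (\<Delta> \<bullet> f)\<bar>" by linarith
        also have "\<bar>(\<Delta> \<bullet> e) * (w \<bullet> f)\<bar> \<le> ((\<nu> * \<eta> / 4) * \<bar>t - s\<bar>) * n"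
          unfolding abs_mult using \<Delta> inner_f[of w] n by (intro mult_mono) (auto simp: n_def)
        also have "\<bar>(w \<bullet> e) * (\<Delta> \<bullet> f)\<bar> \<le> n * ((\<nu> * \<eta> / 4) * \<bar>t - s\<bar>)"
          unfolding abs_mult using \<Delta> inner_e[of w] n by (intro mult_mono) (auto simp: n_def)
        also have "\<bar>((t - s) * \<nu>) * (w \<bullet> f)\<bar> = \<bar>t - s\<bar> * \<nu> * \<bar>w \<bullet> f\<bar>"
          using \<open>0 < \<nu>\<close> by (simp add: abs_mult)
        finally have "\<bar>t - s\<bar> * \<nu> * \<bar>w \<bullet> f\<bar> \<le> \<bar>g s\<bar> + \<bar>g t\<bar> + (\<nu> * \<eta> * n * \<bar>t - s\<bar>) / 2"
          by (simp add: algebra_simps)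
        moreover have "\<bar>t - s\<bar> * \<nu> * (\<eta> * n) \<le> \<bar>t - s\<bar> * \<nu> * \<bar>w \<bullet> f\<bar>"
          using True \<open>0 < \<nu>\<close> by (intro mult_left_mono) auto
        ultimately have "\<bar>t - s\<bar> * (\<nu> * \<eta> * n) / 2 \<le> 2 * (h * R\<^sup>2)"
          using g_le[OF s] g_le[OF t] by (simp add: algebra_simps)
        then show ?thesis
          using \<open>0 < \<nu>\<close> \<eta> n by (simp add: d_def pos_le_divide_eq)
      qed
      then have "A \<subseteq> {s - d .. s + d}" by (force simp: abs_le_iff)
      then have "measure lborel A \<le> measure lborel {s - d .. s + d}"
        using A(2) by (intro measure_mono_fmeasurable) (auto simp: fmeasurable_def emeasure_lborel_Icc_eq)
      also have "\<dots> = 2 * d"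
      proof -
        have "0 \<le> d" using \<open>0 < h\<close> \<open>0 < \<nu>\<close> \<eta> n by (simp add: d_def)
        then show ?thesis by simp
      qed
      also have "\<dots> = 32 * R^3 / (\<nu> * k) * h / n"
        using \<open>0 < R\<close> \<open>0 < k\<close> by (simp add: d_def \<eta>_def field_simps power2_eq_square power3_eq_cube)
      finally show ?thesis using first_nonneg by linarith
    next
      case False
      have "n \<le> \<bar>w \<bullet> e\<bar> + \<bar>w \<bullet> f\<bar>" using ef[of w] by (simp add: n_def)
      moreover have "\<eta> * n \<le> 1/4 * n" using \<eta> n by (intro mult_right_mono) auto
      ultimately have we: "3/4 * n \<le> \<bar>w \<bullet> e\<bar>" using False by linarith
      have "3/4 * n * k \<le> \<bar>w \<bullet> e\<bar> * \<bar>(x - \<gamma> s) \<bullet> f\<bar>"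
        using we x[OF s'] n \<open>0 < k\<close> by (intro mult_mono) auto
      also have "\<dots> = \<bar>(w \<bullet> e) * ((x - \<gamma> s) \<bullet> f)\<bar>" by (simp add: abs_mult)
      also have "\<dots> \<le> \<bar>g s\<bar> + \<bar>((x - \<gamma> s) \<bullet> e) * (w \<bullet> f)\<bar>" by (simp add: g_def)
      also have "\<bar>((x - \<gamma> s) \<bullet> e) * (w \<bullet> f)\<bar> \<le> R * (\<eta> * n)"
        unfolding abs_mult using False x[OF s'] inner_e[of "x - \<gamma> s"] \<open>0 < R\<close> by (intro mult_mono) auto
      also have "R * (\<eta> * n) = k * n / 4" using \<open>0 < R\<close> by (simp add: \<eta>_def)
      finally have "n * k \<le> 2 * h * R\<^sup>2" using g_le[OF s] by (simp add: algebra_simps)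
      \<comment> \<open>The existence of one \<open>s \<in> A\<close> already bounds
        \<open>h / n\<close> from below, so the trivial bound \<open>\<beta> - \<alpha>\<close> is
        good enough.\<close>
      then have "1 \<le> 2 * R\<^sup>2 / k * h / n" using n \<open>0 < k\<close> by (simp add: field_simps)
      have "A \<subseteq> {\<alpha>..\<beta>}" unfolding A(1) by blast
      then have "measure lborel A \<le> measure lborel {\<alpha>..\<beta>}"
        using A(2) by (intro measure_mono_fmeasurable) (auto simp: fmeasurable_def emeasure_lborel_Icc_eq)
      also have "\<dots> = (\<beta> - \<alpha>) * 1" using \<open>\<alpha> < \<beta>\<close> by simp
      also have "\<dots> \<le> (\<beta> - \<alpha>) * (2 * R\<^sup>2 / k * h / n)"
        using \<open>1 \<le> _\<close> \<open>\<alpha> < \<beta>\<close> by (intro mult_left_mono) auto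
      finally show ?thesis using first_nonneg by (simp add: algebra_simps)
    qed
  qed (use first_nonneg in simp)
  then show ?thesis by (simp add: n algebra_simps add_divide_distrib)
qed

subsection \<open>A transversal arc\<close>

text \<open>Mean value inequality for \<open>\<gamma> t - t *\<^sub>R D t0\<close>, whose derivative
  \<open>D t - D t0\<close> is small near \<open>t0\<close>.\<close>

lemma chord_approx_of_continuous_derivative:
  fixes \<gamma> :: "real \<Rightarrow> 'a::real_normed_vector"
  assumes "open U" "t0 \<in> U" and deriv: "\<And>t. t \<in> U \<Longrightarrow> (\<gamma> has_vector_derivative D t) (at t)"
    and "continuous (at t0) D" "0 < \<epsilon>"
  obtains \<delta> where "0 < \<delta>" "{t0 - \<delta> .. t0 + \<delta>} \<subseteq> U"
    "\<And>s t. s \<in> {t0 - \<delta> .. t0 + \<delta>} \<Longrightarrow> t \<in> {t0 - \<delta> .. t0 + \<delta>} \<Longrightarrow>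
       norm (\<gamma> t - \<gamma> s - (t - s) *\<^sub>R D t0) \<le> \<epsilon> * \<bar>t - s\<bar>"
proof -
  obtain d1 where d1: "0 < d1" "\<And>t. \<bar>t - t0\<bar> < d1 \<Longrightarrow> norm (D t - D t0) < \<epsilon>"
    using assms(4,5) unfolding continuous_at_eps_delta dist_norm real_norm_def by blast
  obtain d2 where d2: "0 < d2" "cball t0 d2 \<subseteq> U"
    using assms(1,2) open_contains_cball by blast
  define \<delta> where "\<delta> = min (d1 / 2) d2"
  have \<delta>: "0 < \<delta>" "\<delta> < d1" "\<delta> \<le> d2" using d1 d2 by (auto simp: \<delta>_def)
  let ?J = "{t0 - \<delta> .. t0 + \<delta>}"
  have J: "?J \<subseteq> U" using d2 \<delta> by (force simp: cball_def dist_real_def)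
  have "norm (\<gamma> t - \<gamma> s - (t - s) *\<^sub>R D t0) \<le> \<epsilon> * \<bar>t - s\<bar>" if "s \<in> ?J" "t \<in> ?J" for s t
  proof -
    have "norm ((\<gamma> t - t *\<^sub>R D t0) - (\<gamma> s - s *\<^sub>R D t0)) \<le> \<epsilon> * norm (t - s)"
    proof (rule differentiable_bound[of ?J _ "\<lambda>u h. h *\<^sub>R (D u - D t0)"])
      fix u assume u: "u \<in> ?J"
      then have "(\<gamma> has_vector_derivative D u) (at u within ?J)"
        using deriv J by (blast intro: has_vector_derivative_at_within)
      then show "((\<lambda>u. \<gamma> u - u *\<^sub>R D t0) has_derivative (\<lambda>h. h *\<^sub>R (D u - D t0))) (at u within ?J)"
        unfolding has_vector_derivative_def by (auto intro!: derivative_eq_intros simp: algebra_simps)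
      have "norm (D u - D t0) \<le> \<epsilon>" using d1(2)[of u] u \<delta> by (auto simp: abs_less_iff less_imp_le)
      then show "onorm (\<lambda>h. h *\<^sub>R (D u - D t0)) \<le> \<epsilon>"
        by (intro onorm_le) (simp add: mult.commute[of \<epsilon>] mult_left_mono)
    qed (use that in auto)
    then show ?thesis by (simp add: algebra_simps)
  qed
  with that \<delta> J show ?thesis by blast
qed


text \<open>At an interior parameter \<open>t0\<close> the square misses the tangent line, so the
  normal component of \<open>x - \<gamma> t0\<close> has no zero on it. By connectedness its sign is
  constant, by compactness it is bounded away from 0, and both this bound and the direction of
  chords persist on a short arc.\<close>

lemma transversal_arc:
  fixes \<gamma> :: "real \<Rightarrow> real^2"
  assumes curve: "smooth_curve_param I \<gamma>"
    and tangents: "\<And>t. t \<in> I \<Longrightarrow> tangent_line I \<gamma> t \<inter> square 0 1 = {}"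
    and "0 < R"
  obtains \<alpha> \<beta> e f k \<nu> where "\<alpha> < \<beta>" "{\<alpha>..\<beta>} \<subseteq> I" "norm e = 1" "norm f = 1" "e \<bullet> f = 0"
    "\<And>z::real^2. norm z \<le> \<bar>z \<bullet> e\<bar> + \<bar>z \<bullet> f\<bar>" "0 < k" "0 < \<nu>" "continuous_on {\<alpha>..\<beta>} \<gamma>"
    "\<And>t x. t \<in> {\<alpha>..\<beta>} \<Longrightarrow> x \<in> square 0 1 \<Longrightarrow> k \<le> (x - \<gamma> t) \<bullet> f"
    "\<And>s t. s \<in> {\<alpha>..\<beta>} \<Longrightarrow> t \<in> {\<alpha>..\<beta>} \<Longrightarrow>
        norm (\<gamma> t - \<gamma> s - ((t - s) * \<nu>) *\<^sub>R e) \<le> (\<nu> * k / (16 * R)) * \<bar>t - s\<bar>"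
proof -
  obtain a b where ab: "a \<in> I" "b \<in> I" "a < b" and "is_interval I"
    using curve unfolding smooth_curve_param_def by blast
  \<comment> \<open>On an open subinterval the one-sided derivatives of the definition become
    ordinary ones.\<close>
  then have sub: "{a<..<b} \<subseteq> I"
    by (meson greaterThanLessThan_iff less_imp_le mem_is_interval_1_I subsetI)
  from curve have "\<exists>D. D 0 = \<gamma> \<and> (\<forall>k. \<forall>t\<in>I. (D k has_vector_derivative D (Suc k) t) (at t within I))"
    unfolding smooth_curve_param_def smooth_on_interval_def by (elim conjE)
  then obtain D where "D 0 = \<gamma>"
    and "\<forall>k. \<forall>t\<in>I. (D k has_vector_derivative D (Suc k) t) (at t within I)"
    by (elim exE conjE)
  then have D: "(D k has_vector_derivative D (Suc k) t) (at t within I)" if "t \<in> I" for k t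
    using that by simp
  have at_I: "at t within I = at t" if "t \<in> {a<..<b}" for t
    using that sub by (intro at_within_interior) (meson interior_maximal open_greaterThanLessThan subsetD)
  have deriv: "(D k has_vector_derivative D (Suc k) t) (at t)" if "t \<in> {a<..<b}" for k t
    using D[of t k] at_I[OF that] that sub by (metis subsetD)
  define t0 where "t0 = (a + b) / 2"
  have t0: "t0 \<in> {a<..<b}" using ab by (simp add: t0_def)
  define v where "v = D 1 t0"
  have "vector_derivative \<gamma> (at t0 within I) = v"
    using deriv[OF t0, of 0] at_I[OF t0] \<open>D 0 = \<gamma>\<close> by (simp add: v_def vector_derivative_at)
  then have "v \<noteq> 0" and line: "\<And>r. \<gamma> t0 + r *\<^sub>R v \<notin> square 0 1"
    using curve tangents[of t0] t0 sub by (force simp: smooth_curve_param_def tangent_line_def)+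
  define e where "e = (1 / norm v) *\<^sub>R v"
  have e: "norm e = 1" "v = norm v *\<^sub>R e" using \<open>v \<noteq> 0\<close> by (simp_all add: e_def)
  \<comment> \<open>The quarter turn of \<open>e\<close>; the sign \<open>\<sigma>\<close> below
    turns it towards the square.\<close>
  define p :: "real^2" where "p = vector [- e $ 2, e $ 1]"
  have e12: "(e $ 1)\<^sup>2 + (e $ 2)\<^sup>2 = 1"
    using e(1) by (simp add: norm_eq_1 inner_vec_def sum_2 power2_eq_square)
  have p: "norm p = 1" "e \<bullet> p = 0"
    using e12 by (simp_all add: p_def norm_eq_1 inner_vec_def sum_2 power2_eq_square)
  have decomp: "z = (z \<bullet> e) *\<^sub>R e + (z \<bullet> p) *\<^sub>R p" for z
  proof -
    have "z $ i = z $ i * ((e $ 1)\<^sup>2 + (e $ 2)\<^sup>2)" for i using e12 by simp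
    from this[of 1] this[of 2] show ?thesis
      by (simp add: vec_eq_iff forall_2 p_def inner_vec_def sum_2 power2_eq_square algebra_simps)
  qed
  have "(x - \<gamma> t0) \<bullet> p \<noteq> 0" if "x \<in> square 0 1" for x
  proof
    assume "(x - \<gamma> t0) \<bullet> p = 0"
    then have "x - \<gamma> t0 = ((x - \<gamma> t0) \<bullet> e) *\<^sub>R e" using decomp[of "x - \<gamma> t0"] by simp
    also have "\<dots> = (((x - \<gamma> t0) \<bullet> e) / norm v) *\<^sub>R v"
      by (subst (2) e_def) simp
    finally have "\<gamma> t0 + (((x - \<gamma> t0) \<bullet> e) / norm v) *\<^sub>R v = x"
      by (metis add_diff_cancel_left' diff_add_cancel add.commute)
    with line[of "((x - \<gamma> t0) \<bullet> e) / norm v"] that show False by simp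
  qed
  moreover have "connected ((\<lambda>x. (x - \<gamma> t0) \<bullet> p) ` square 0 1)"
    unfolding square_def
    by (intro connected_continuous_image continuous_intros convex_connected convex_box)
  ultimately have sign: "(\<forall>x\<in>square 0 1. 0 < (x - \<gamma> t0) \<bullet> p) \<or> (\<forall>x\<in>square 0 1. (x - \<gamma> t0) \<bullet> p < 0)"
    unfolding connected_iff_interval by (smt (verit) imageE imageI)
  have "\<exists>\<sigma>::real. \<bar>\<sigma>\<bar> = 1 \<and> (\<forall>x\<in>square 0 1. 0 < (x - \<gamma> t0) \<bullet> (\<sigma> *\<^sub>R p))"
    using sign
  proof
    assume "\<forall>x\<in>square 0 1. 0 < (x - \<gamma> t0) \<bullet> p"
    then show ?thesis by (intro exI[of _ 1]) simp
  next
    assume "\<forall>x\<in>square 0 1. (x - \<gamma> t0) \<bullet> p < 0"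
    then show ?thesis by (intro exI[of _ "- 1"]) simp
  qed
  then obtain \<sigma> :: real where \<sigma>: "\<bar>\<sigma>\<bar> = 1" "\<And>x. x \<in> square 0 1 \<Longrightarrow> 0 < (x - \<gamma> t0) \<bullet> (\<sigma> *\<^sub>R p)"
    by blast
  define f where "f = \<sigma> *\<^sub>R p"
  have f: "norm f = 1" "e \<bullet> f = 0" "\<And>z. \<bar>z \<bullet> f\<bar> = \<bar>z \<bullet> p\<bar>" using \<sigma> p by (auto simp: f_def abs_mult)
  have ef: "norm z \<le> \<bar>z \<bullet> e\<bar> + \<bar>z \<bullet> f\<bar>" for z
  proof -
    have "norm z \<le> norm ((z \<bullet> e) *\<^sub>R e) + norm ((z \<bullet> p) *\<^sub>R p)"
      by (metis decomp norm_triangle_ineq)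
    then show ?thesis using e p f by simp
  qed
  have "square 0 1 \<noteq> {}"
    unfolding square_def by (auto simp: interval_ne_empty_cart forall_2 intro!: exI[of _ 0] simp: mem_box_cart)
  moreover have "compact (square 0 1)" by (simp add: square_def compact_cbox)
  ultimately obtain x0 where x0: "x0 \<in> square 0 1"
    "\<And>x. x \<in> square 0 1 \<Longrightarrow> (x0 - \<gamma> t0) \<bullet> f \<le> (x - \<gamma> t0) \<bullet> f"
    using continuous_attains_inf[of "square 0 1" "\<lambda>x. (x - \<gamma> t0) \<bullet> f"]
    by (force intro!: continuous_intros)
  \<comment> \<open>Half of the minimum: the other half absorbs the displacement of
    \<open>\<gamma> t\<close> from \<open>\<gamma> t0\<close>, which is kept below
    \<open>k\<close>.\<close>
  define k where "k = (x0 - \<gamma> t0) \<bullet> f / 2"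
  have k: "0 < k" "\<And>x. x \<in> square 0 1 \<Longrightarrow> 2 * k \<le> (x - \<gamma> t0) \<bullet> f"
    using \<sigma> x0 by (auto simp: k_def f_def)
  define \<nu> where "\<nu> = norm v"
  have \<nu>: "0 < \<nu>" "v = \<nu> *\<^sub>R e" using \<open>v \<noteq> 0\<close> e by (simp_all add: \<nu>_def)
  have "continuous (at t) \<gamma>" "continuous (at t) (D 1)" if "t \<in> {a<..<b}" for t
    using deriv[OF that, of 0] deriv[OF that, of 1] \<open>D 0 = \<gamma>\<close>
    by (auto intro: has_vector_derivative_continuous)
  note cont = this
  obtain \<delta> where \<delta>: "0 < \<delta>" "{t0 - \<delta>..t0 + \<delta>} \<subseteq> {a<..<b}"
    "\<And>s t. s \<in> {t0 - \<delta> .. t0 + \<delta>} \<Longrightarrow> t \<in> {t0 - \<delta> .. t0 + \<delta>} \<Longrightarrow>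
       norm (\<gamma> t - \<gamma> s - (t - s) *\<^sub>R D 1 t0) \<le> (\<nu> * k / (16 * R)) * \<bar>t - s\<bar>"
    using chord_approx_of_continuous_derivative[of "{a<..<b}" t0 \<gamma> "D 1" "\<nu> * k / (16 * R)"]
      deriv[of _ 0] \<open>D 0 = \<gamma>\<close> t0 cont(2)[OF t0] \<nu> k \<open>0 < R\<close>
    by (auto simp del: greaterThanLessThan_iff)
  obtain \<delta>' where \<delta>': "0 < \<delta>'" "\<And>t. \<bar>t - t0\<bar> < \<delta>' \<Longrightarrow> norm (\<gamma> t - \<gamma> t0) < k"
    using cont(1)[OF t0] k unfolding continuous_at_eps_delta dist_norm real_norm_def by blast
  define d where "d = min \<delta> (\<delta>' / 2)"
  have d: "0 < d" "d \<le> \<delta>" "d < \<delta>'" using \<delta> \<delta>' by (auto simp: d_def)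
  have d_sub: "{t0 - d..t0 + d} \<subseteq> {a<..<b}"
    by (rule order_trans[OF _ \<delta>(2)]) (use d in auto)
  show thesis
  proof (rule that[of "t0 - d" "t0 + d" e f k \<nu>])
    show "{t0 - d..t0 + d} \<subseteq> I" using d_sub sub by blast
    show "continuous_on {t0 - d..t0 + d} \<gamma>"
      using d_sub cont(1) by (intro continuous_at_imp_continuous_on) blast
    fix t x assume t: "t \<in> {t0 - d..t0 + d}" and x: "x \<in> square 0 1"
    have "\<bar>(\<gamma> t - \<gamma> t0) \<bullet> f\<bar> \<le> norm (\<gamma> t - \<gamma> t0)"
      using Cauchy_Schwarz_ineq2[of "\<gamma> t - \<gamma> t0" f] f by simp
    also have "\<dots> < k" using t d by (intro \<delta>'(2)) auto
    finally show "k \<le> (x - \<gamma> t) \<bullet> f" using k(2)[OF x] by (simp add: inner_diff_left)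
  next
    fix s t assume "s \<in> {t0 - d..t0 + d}" "t \<in> {t0 - d..t0 + d}"
    then show "norm (\<gamma> t - \<gamma> s - ((t - s) * \<nu>) *\<^sub>R e) \<le> (\<nu> * k / (16 * R)) * \<bar>t - s\<bar>"
      using \<delta>(3)[of s t] d \<nu>(2) by (simp add: v_def)
  qed (use d e f ef k \<nu> in auto)
qed

subsection \<open>Integrated visibility\<close>

text \<open>If \<open>emeasure M A\<close> is infinite, then \<open>measure M A\<close> is 0 by
  convention.\<close>

lemma ennreal_measure_le: "ennreal (measure M A) \<le> emeasure M A"
  by (simp add: measure_def ennreal_enn2real_if)

theorem corollary1p8:
  fixes \<Gamma> :: "(real^2) set" and \<gamma> :: "real \<Rightarrow> real^2" and I :: "real set" and c1 c2 :: real
  assumes curve: "smooth_curve_param I \<gamma>" "\<Gamma> = \<gamma> ` I"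
    and c_bounds: "0 < c1" "c1 \<le> c2"
    and dist_bounds: "\<And>x a. x \<in> square 0 1 \<Longrightarrow> a \<in> \<Gamma> \<Longrightarrow> c1 \<le> norm (x - a) \<and> norm (x - a) \<le> c2"
    and tangents: "\<And>t. t \<in> I \<Longrightarrow> tangent_line I \<gamma> t \<inter> square 0 1 = {}"
  shows "\<exists>c::real. c > 0 \<and>
           (\<forall>n::nat. n \<ge> 1 \<longrightarrow> (\<integral>\<^sup>+a\<in>\<Gamma>. vis a (four_corner n) \<partial>hausdorff1) \<ge> ennreal (c / real n))"
proof -

  \<comment> \<open>The arc and the constants\<close>
  have R: "0 < c2" using c_bounds by simp
  from transversal_arc[OF curve(1) tangents R]
  obtain \<alpha> \<beta> e f k \<nu> where arc: "\<alpha> < \<beta>" "{\<alpha>..\<beta>} \<subseteq> I" and e: "norm e = 1" and f: "norm f = 1" "e \<bullet> f = 0"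
    and ef: "\<And>z::real^2. norm z \<le> \<bar>z \<bullet> e\<bar> + \<bar>z \<bullet> f\<bar>" and k: "0 < k" and \<nu>: "0 < \<nu>"
    and cont: "continuous_on {\<alpha>..\<beta>} \<gamma>"
    and k_le: "\<And>t x. t \<in> {\<alpha>..\<beta>} \<Longrightarrow> x \<in> square 0 1 \<Longrightarrow> k \<le> (x - \<gamma> t) \<bullet> f"
    and chord: "\<And>s t. s \<in> {\<alpha>..\<beta>} \<Longrightarrow> t \<in> {\<alpha>..\<beta>} \<Longrightarrow>
        norm (\<gamma> t - \<gamma> s - ((t - s) * \<nu>) *\<^sub>R e) \<le> (\<nu> * k / (16 * c2)) * \<bar>t - s\<bar>"
    by blast
  let ?J = "{\<alpha>..\<beta>}"
  have le_c2: "norm (x - \<gamma> t) \<le> c2" if "t \<in> ?J" "x \<in> square 0 1" for t x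
    using dist_bounds[OF that(2), of "\<gamma> t"] that(1) arc(2) curve(2) by blast
  have inner_f: "\<bar>z \<bullet> f\<bar> \<le> norm z" for z using Cauchy_Schwarz_ineq2[of z f] f by simp
  have "0 \<in> square 0 1" by (simp add: square_def mem_box_cart forall_2)
  then have "k \<le> c2"
    using k_le[of \<alpha> 0] le_c2[of \<alpha> 0] inner_f[of "0 - \<gamma> \<alpha>"] arc(1) by auto
  \<comment> \<open>The chord error is at most half of the main term. This makes
    \<open>\<gamma>\<close> injective on the arc with a Lipschitz inverse, which bounds lengths on
    the arc from below.\<close>
  have expand: "\<nu> / 2 * \<bar>t - s\<bar> \<le> dist (\<gamma> t) (\<gamma> s)" if "s \<in> ?J" "t \<in> ?J" for s t
  proof -
    have "\<nu> * k / (16 * c2) \<le> \<nu> / 2"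
      using \<open>k \<le> c2\<close> R \<nu> k by (simp add: field_simps)
    then have "(\<nu> * k / (16 * c2)) * \<bar>t - s\<bar> \<le> \<nu> / 2 * \<bar>t - s\<bar>" by (intro mult_right_mono) auto
    moreover have "norm (((t - s) * \<nu>) *\<^sub>R e) = \<nu> * \<bar>t - s\<bar>" using e \<nu> by (simp add: abs_mult)
    ultimately show ?thesis
      using chord[OF that] norm_triangle_ineq2[of "((t - s) * \<nu>) *\<^sub>R e" "\<gamma> t - \<gamma> s"]
      by (simp add: dist_norm norm_minus_commute)
  qed
  define len where "len = \<beta> - \<alpha>"
  have len: "0 < len" using arc by (simp add: len_def)
  \<comment> \<open>\<open>C\<close> is the constant of \<open>measure_close_slopes_le\<close> for
    \<open>R = c2\<close>. In \<open>K\<close> the summand \<open>len\<close> accounts for the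
    diagonal pairs and \<open>C / c2\<close> for the others.\<close>
  define C where "C = 32 * c2^3 / (\<nu> * k) + 2 * c2\<^sup>2 * len / k"
  have C: "0 < C" using R \<nu> k len by (auto simp: C_def intro!: add_pos_pos)
  define K where "K = len + C / c2"
  have K: "0 < K" using C len R by (simp add: K_def add_pos_pos)
  \<comment> \<open>The inverse Lipschitz constant of the slope times \<open>n\<close> times the
    lower bound for the measure of the set of slopes. In \<open>c\<close> the factor
    \<open>\<nu> * len / 4\<close> bounds the length of the good part of the arc.\<close>
  define V where "V = (k\<^sup>2 / (2 * c2\<^sup>2)) * (len / (4 * c2 * K))"
  define c where "c = V * (\<nu> * len / 4)"
  have V: "0 < V" using k R len K by (simp add: V_def)
  have "0 < c" using V \<nu> len by (simp add: c_def)
  have "ennreal (c / real n) \<le> (\<integral>\<^sup>+a\<in>\<Gamma>. vis a (four_corner n) \<partial>hausdorff1)" if "1 \<le> n" for n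
  proof -

    \<comment> \<open>Close pairs of squares at generation \<open>n\<close>\<close>
    define r where "r = (1/4 :: real) ^ n"
    \<comment> \<open>The length of the slope interval that \<open>Icc_subset_slope_square\<close>
      yields for a square of side \<open>r\<close>.\<close>
    define h where "h = r / (2 * c2)"
    define Q where "Q = cantor_corners n"
    define m where "m p = p + (r / 2) *\<^sub>R vector [1, 1]" for p :: "real^2"
    define S where "S p t = slope e f (\<gamma> t) (m p)" for p t
    define A where "A p q = {t \<in> ?J. \<bar>S p t - S q t\<bar> \<le> h}" for p q
    \<comment> \<open>For \<open>t\<close> in the parameter interval, \<open>N t\<close> counts the
      ordered pairs with \<open>h\<close>-close slopes. The threshold \<open>B\<close> is twice the
      bound \<open>K * n * 4^n / len\<close> for its mean, so that Markov's inequality leaves at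
      least half of the parameters in \<open>T\<close>.\<close>
    define N where "N t = (\<Sum>p\<in>Q. \<Sum>q\<in>Q. indicator (A p q) t :: real)" for t
    define B where "B = 2 * K * real n * 4 ^ n / len"
    define T where "T = {t \<in> ?J. N t \<le> B}"
    have r: "0 < r" by (simp add: r_def)
    have h: "0 < h" using r R by (simp add: h_def)
    have Q: "finite Q" "card Q = 4 ^ n" by (simp_all add: Q_def finite_cantor_corners card_cantor_corners)
    have m: "m p \<in> square 0 1" if "p \<in> Q" for p
    proof -
      have "m p \<in> square p r" using r by (simp add: m_def square_def mem_box_cart forall_2)
      then show ?thesis using cantor_corners_subset_square that by (auto simp: Q_def r_def)
    qed
    have S_cont: "continuous_on ?J (S p)" if "p \<in> Q" for p
      unfolding S_def slope_def using k_le[OF _ m[OF that]] k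
      by (intro continuous_intros cont) fastforce
    have A_closed: "closed (A p q)" if "p \<in> Q" "q \<in> Q" for p q
    proof -
      have "A p q = ?J \<inter> (\<lambda>t. S p t - S q t) -` {- h .. h}" by (auto simp: A_def abs_le_iff)
      moreover have "continuous_on ?J (\<lambda>t. S p t - S q t)"
        using S_cont that by (intro continuous_on_diff) auto
      ultimately show ?thesis
        using continuous_closed_preimage[of ?J _ "{- h .. h}"] by simp
    qed
    have N_meas: "N \<in> borel_measurable lborel"
      unfolding N_def using A_closed by (intro borel_measurable_sum borel_measurable_indicator) auto
    have T_meas: "T \<in> sets lborel" unfolding T_def using N_meas by measurable
    have A_meas: "A p q \<in> fmeasurable lborel" if "p \<in> Q" "q \<in> Q" for p q
    proof (rule fmeasurableI2[of ?J])
      show "A p q \<in> sets lborel" using A_closed[OF that] by simp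
    qed (auto simp: A_def fmeasurable_def emeasure_lborel_Icc_eq)
    have A_le: "measure lborel (A p q) \<le> (if p = q then len else 0) + C * h * (1 / norm (p - q))"
      if "p \<in> Q" "q \<in> Q" for p q
    proof (cases "p = q")
      case True
      have "measure lborel (A p q) \<le> measure lborel ?J"
        using A_meas[OF that]
        by (intro measure_mono_fmeasurable) (auto simp: A_def fmeasurable_def emeasure_lborel_Icc_eq)
      with True arc show ?thesis by (simp add: len_def)
    next
      case False
      have "measure lborel (A p q) \<le> C * h / norm (m p - m q)"
        unfolding C_def len_def
      proof (rule measure_close_slopes_le[OF e f(1) ef f(2) arc(1) k R \<nu> h chord])
        show "A p q = {t \<in> ?J. \<bar>slope e f (\<gamma> t) (m p) - slope e f (\<gamma> t) (m q)\<bar> \<le> h}"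
          by (simp add: A_def S_def)
        show "A p q \<in> sets lborel" using A_meas[OF that] by auto
        show "m p \<noteq> m q" using False by (simp add: m_def)
      qed (use k_le le_c2 m that in auto)
      with False show ?thesis by (simp add: m_def)
    qed
    have "(\<Sum>p\<in>Q. \<Sum>q\<in>Q. measure lborel (A p q))
        \<le> (\<Sum>p\<in>Q. \<Sum>q\<in>Q. (if p = q then len else 0) + C * h * (1 / norm (p - q)))"
      by (intro sum_mono A_le)
    also have "\<dots> = 4 ^ n * len + C * h * (\<Sum>p\<in>Q. \<Sum>q\<in>Q. 1 / norm (p - q))"
      using Q by (simp add: sum.distrib sum_distrib_left)
    also have "\<dots> \<le> 4 ^ n * len + C * h * (2 * real n * 16 ^ n)"
      using cantor_corners_energy[of n] C h by (simp add: Q_def mult_left_mono)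
    also have "C * h * (2 * real n * 16 ^ n) = (C / c2) * real n * 4 ^ n"
    proof -
      have "r * 16 ^ n = 4 ^ n" by (simp add: r_def flip: power_mult_distrib)
      then show ?thesis by (simp add: h_def algebra_simps)
    qed
    also have "4 ^ n * len + (C / c2) * real n * 4 ^ n \<le> K * real n * 4 ^ n"
    proof -
      \<comment> \<open>The diagonal contribution carries no factor \<open>n\<close>;
        \<open>1 \<le> n\<close> lets the main term absorb it.\<close>
      have "len * 1 \<le> len * real n" using that len by (intro mult_left_mono) auto
      then have "(len + (C / c2) * real n) * 4 ^ n \<le> (K * real n) * 4 ^ n"
        by (intro mult_right_mono) (auto simp: K_def algebra_simps)
      then show ?thesis by (simp add: algebra_simps)
    qed
    finally have sum_A: "(\<Sum>p\<in>Q. \<Sum>q\<in>Q. measure lborel (A p q)) \<le> K * real n * 4 ^ n" .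
    have B: "0 < B" using K len that by (simp add: B_def)

    \<comment> \<open>Markov's inequality for the good parameters\<close>
    have T_large: "len / 2 \<le> measure lborel T"
    proof -
      have T_fm: "T \<in> fmeasurable lborel"
        by (rule fmeasurableI2[of ?J]) (use T_meas in \<open>auto simp: T_def fmeasurable_def emeasure_lborel_Icc_eq\<close>)
      have int_A: "integrable lborel (indicator (A p q) :: real \<Rightarrow> real)" if "p \<in> Q" "q \<in> Q" for p q
        using A_meas[OF that] by (simp add: fmeasurable_def)
      then have int_N: "integrable lborel N"
        unfolding N_def by (intro Bochner_Integration.integrable_sum) auto
      have int_JT: "integrable lborel (indicator (?J - T) :: real \<Rightarrow> real)"
        using fmeasurable.Diff[of ?J lborel T] T_fm
        by (intro integrable_real_indicator) (auto simp: fmeasurable_def emeasure_lborel_Icc_eq)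
      have "B * measure lborel (?J - T) = (\<integral>t. B * indicator (?J - T) t \<partial>lborel)"
        by simp
      also have "\<dots> \<le> (\<integral>t. N t \<partial>lborel)"
      proof (rule integral_mono)
        fix t
        have "0 \<le> N t" by (simp add: N_def sum_nonneg)
        then show "B * indicator (?J - T) t \<le> N t"
          by (auto simp: indicator_def T_def)
      qed (use int_N int_JT in auto)
      also have "\<dots> = (\<Sum>p\<in>Q. \<Sum>q\<in>Q. measure lborel (A p q))"
        unfolding N_def using int_A by (simp add: Bochner_Integration.integral_sum)
      also have "\<dots> \<le> B * (len / 2)" using sum_A len by (simp add: B_def)
      finally have "measure lborel (?J - T) \<le> len / 2" using B by simp
      moreover have "measure lborel ?J = measure lborel T + measure lborel (?J - T)"
      proof -
        have "T \<union> ?J = ?J" by (auto simp: T_def)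
        then show ?thesis
          using measure_Un2[OF T_fm, of ?J] by (simp add: fmeasurable_def emeasure_lborel_Icc_eq)
      qed
      ultimately show ?thesis using arc by (simp add: len_def)
    qed

    \<comment> \<open>Visibility from the good points\<close>
    have vis_ge: "ennreal (V / real n) \<le> vis a (four_corner n)" if a: "a \<in> \<gamma> ` T" for a
    proof -
      obtain t where t: "t \<in> T" "a = \<gamma> t" using a by blast
      then have tJ: "t \<in> ?J" by (simp add: T_def)
      define U where "U = (\<Union>p\<in>Q. {S p t .. S p t + h})"
      have U_meas: "U \<in> sets borel" using Q by (auto simp: U_def)
      have "U \<subseteq> slope e f a ` four_corner n"
        unfolding U_def
      proof (rule UN_least)
        fix p assume p: "p \<in> Q"
        have "{S p t .. S p t + h} \<subseteq> slope e f a ` square p r"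
          unfolding S_def h_def t(2)
        proof (rule Icc_subset_slope_square[OF e f(2)])
          show "0 < (m p - \<gamma> t) \<bullet> f" using k_le[OF tJ m[OF p]] k by simp
          show "(m p - \<gamma> t) \<bullet> f \<le> c2" using le_c2[OF tJ m[OF p]] inner_f[of "m p - \<gamma> t"] by simp
        qed (use r m_def in auto)
        also have "square p r \<subseteq> four_corner n" using p by (auto simp: four_corner_def Q_def r_def)
        finally show "{S p t .. S p t + h} \<subseteq> slope e f a ` four_corner n" by blast
      qed
      have "four_corner n \<subseteq> square 0 1"
        using cantor_corners_subset_square by (auto simp: four_corner_def)
      then have "emeasure lborel U \<le> ennreal (2 * c2\<^sup>2 / k\<^sup>2) * vis a (four_corner n)"
        using k_le[OF tJ] le_c2[OF tJ] \<open>U \<subseteq> _\<close> U_meas t(2)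
        by (intro lborel_le_vis[OF e f(1) k R]) auto
      have "N t = real (card {(p, q) \<in> Q \<times> Q. \<bar>S p t - S q t\<bar> \<le> h})"
      proof -
        have "N t = (\<Sum>z\<in>Q \<times> Q. indicator {(p, q). \<bar>S p t - S q t\<bar> \<le> h} z)"
          unfolding N_def sum.cartesian_product
          using tJ by (intro sum.cong) (auto simp: A_def indicator_def)
        also have "\<dots> = real (card ((Q \<times> Q) \<inter> {(p, q). \<bar>S p t - S q t\<bar> \<le> h}))"
          using Q by (simp add: indicator_def)
        also have "(Q \<times> Q) \<inter> {(p, q). \<bar>S p t - S q t\<bar> \<le> h} = {(p, q) \<in> Q \<times> Q. \<bar>S p t - S q t\<bar> \<le> h}"
          by auto
        finally show ?thesis .
      qed
      then have "(4 ^ n)\<^sup>2 * h \<le> N t * measure lborel U"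
        using card_sq_le_overlap_mult_measure_Union[OF Q(1) h, of "\<lambda>p. S p t"] Q(2) by (simp add: U_def)
      also have "\<dots> \<le> B * measure lborel U" using t by (intro mult_right_mono) (auto simp: T_def)
      finally have "(4 ^ n)\<^sup>2 * h / B \<le> measure lborel U" using B by (simp add: field_simps)
      moreover have "(4 ^ n)\<^sup>2 * h / B = len / (4 * c2 * K) / real n"
      proof -
        have "4 ^ n * r = 1" by (simp add: r_def flip: power_mult_distrib)
        then have "(4 ^ n)\<^sup>2 * h = 4 ^ n / (2 * c2)" by (simp add: h_def power2_eq_square)
        then show ?thesis using len K by (simp add: B_def field_simps)
      qed
      ultimately have "ennreal (len / (4 * c2 * K) / real n) \<le> emeasure lborel U"
        by (metis ennreal_leI ennreal_measure_le order_trans)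
      also have "\<dots> \<le> ennreal (2 * c2\<^sup>2 / k\<^sup>2) * vis a (four_corner n)" by fact
      finally have "ennreal (k\<^sup>2 / (2 * c2\<^sup>2)) * ennreal (len / (4 * c2 * K) / real n)
          \<le> ennreal (k\<^sup>2 / (2 * c2\<^sup>2)) * (ennreal (2 * c2\<^sup>2 / k\<^sup>2) * vis a (four_corner n))"
        by (rule mult_left_mono) simp
      also have "\<dots> = vis a (four_corner n)"
        using k R by (simp add: mult.assoc[symmetric] ennreal_mult[symmetric])
      also have "ennreal (k\<^sup>2 / (2 * c2\<^sup>2)) * ennreal (len / (4 * c2 * K) / real n) = ennreal (V / real n)"
        using k R len K by (simp add: V_def ennreal_mult[symmetric])
      finally show ?thesis .
    qed

    \<comment> \<open>Length of the good part of the arc\<close>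
    have \<gamma>T_meas: "\<gamma> ` T \<in> sets borel"
    proof -
      define W where "W = {a. (\<Sum>p\<in>Q. \<Sum>q\<in>Q. indicator {a. \<bar>slope e f a (m p) - slope e f a (m q)\<bar> \<le> h} a :: real) \<le> B}"
      have "W \<in> sets borel" unfolding W_def slope_def by measurable
      moreover have "compact (\<gamma> ` ?J)" using cont by (intro compact_continuous_image) auto
      moreover have "\<gamma> ` T = \<gamma> ` ?J \<inter> W"
        by (auto simp: T_def W_def N_def A_def S_def indicator_def image_iff)
      ultimately show ?thesis
        using sets.Int[OF borel_compact] by metis
    qed
    have inj: "inj_on \<gamma> ?J"
    proof (rule inj_onI)
      fix s t assume "s \<in> ?J" "t \<in> ?J" "\<gamma> s = \<gamma> t"
      then show "s = t" using expand[of s t] \<nu> by (simp add: mult_le_0_iff)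
    qed
    have "emeasure lborel T \<le> ennreal (2 / \<nu>) * hausdorff1_outer (\<gamma> ` T)"
    proof (rule lborel_le_hausdorff1_outer[where f = "the_inv_into ?J \<gamma>"])
      have TJ: "T \<subseteq> ?J" by (auto simp: T_def)
      show "T \<subseteq> the_inv_into ?J \<gamma> ` \<gamma> ` T"
        using TJ inj by (force simp: image_image the_inv_into_f_f)
      fix x y assume "x \<in> \<gamma> ` T" "y \<in> \<gamma> ` T"
      then obtain s t where "s \<in> ?J" "t \<in> ?J" "x = \<gamma> t" "y = \<gamma> s" using TJ by blast
      then show "\<bar>the_inv_into ?J \<gamma> x - the_inv_into ?J \<gamma> y\<bar> \<le> 2 / \<nu> * dist x y"
        using expand[of s t] inj \<nu> by (simp add: the_inv_into_f_f field_simps)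
    qed (use \<nu> T_meas in auto)
    then have "ennreal (len / 2) \<le> ennreal (2 / \<nu>) * hausdorff1_outer (\<gamma> ` T)"
      using T_large by (metis ennreal_leI ennreal_measure_le order_trans)
    then have "ennreal (\<nu> / 2) * ennreal (len / 2) \<le> ennreal (\<nu> / 2) * (ennreal (2 / \<nu>) * hausdorff1_outer (\<gamma> ` T))"
      by (rule mult_left_mono) simp
    also have "\<dots> = emeasure hausdorff1 (\<gamma> ` T)"
      using \<nu> \<gamma>T_meas by (simp add: mult.assoc[symmetric] ennreal_mult[symmetric] emeasure_hausdorff1)
    finally have H: "ennreal (\<nu> / 2) * ennreal (len / 2) \<le> emeasure hausdorff1 (\<gamma> ` T)" .
    have "ennreal (c / real n) = ennreal (V / real n) * (ennreal (\<nu> / 2) * ennreal (len / 2))"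
      using V \<nu> len by (simp add: c_def ennreal_mult[symmetric])
    also have "\<dots> \<le> ennreal (V / real n) * emeasure hausdorff1 (\<gamma> ` T)"
      by (intro mult_left_mono H) simp
    also have "\<dots> = (\<integral>\<^sup>+a. ennreal (V / real n) * indicator (\<gamma> ` T) a \<partial>hausdorff1)"
      using \<gamma>T_meas by (simp add: nn_integral_cmult_indicator)
    also have "\<dots> \<le> (\<integral>\<^sup>+a\<in>\<Gamma>. vis a (four_corner n) \<partial>hausdorff1)"
    proof (rule nn_integral_mono)
      fix a
      have "\<gamma> ` T \<subseteq> \<Gamma>" using arc(2) curve(2) by (auto simp: T_def)
      then show "ennreal (V / real n) * indicator (\<gamma> ` T) a \<le> vis a (four_corner n) * indicator \<Gamma> a"
        using vis_ge[of a] by (auto simp: indicator_def)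
    qed
    finally show ?thesis .
  qed
  with \<open>0 < c\<close> show ?thesis by blast
qed

end
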